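(* Let $\mathbb{F}$ be an arbitrary field and let $E$ be the natural $2$-dimensional representation of $\mathrm{SL}_2(\mathbb{F})$. Let $K, d\in\mathbb{N}_0$. There exist isomorphisms of $\mathrm{SL}_2(\mathbb{F})$-representations: (i) $\mathrm{Sym}^{d+K}E\otimes\mathrm{Sym}_K\mathrm{Sym}^{d}E \cong \mathrm{Sym}^K E\otimes\mathrm{Sym}_{K+1}\mathrm{Sym}^d E$; (ii) $\mathrm{Sym}_K E\otimes\mathrm{Sym}_{K+1}\mathrm{Sym}^{d}E \cong \mathrm{Sym}^{d}E\otimes\mathrm{Sym}_K\mathrm{Sym}^{d+1}E$; (iii) $\mathrm{Sym}_{d+K}E\otimes\mathrm{Sym}_{K}\mathrm{Sym}^{d}E \cong \mathrm{Sym}_{d}E\otimes\mathrm{Sym}_K\mathrm{Sym}^{d+1}E$.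
   Context: $\mathbb{N}_0=\{0,1,2,\ldots\}$. Upper symmetric powers: fixing a basis $X,Y$ of $E$, $\mathrm{Sym}^d E$ is the space of homogeneous polynomials of degree $d$ in $X,Y$ over $\mathbb{F}$, with action $\begin{pmatrix}\alpha&\beta\\ \gamma&\delta\end{pmatrix}\cdot P(X,Y) = P(\alpha X+\gamma Y,\beta X+\delta Y)$. Lower symmetric powers: for a finite-dimensional representation $V$ and $R\in\mathbb{N}_0$, $\mathrm{Sym}_R V = \{w\in V^{\otimes R} : \sigma\cdot w = w \text{ for all } \sigma\in\mathfrak{S}_R\}$, where the symmetric group $\mathfrak{S}_R$ acts by permuting tensor positions, a subrepresentation of $V^{\otimes R}$ with the diagonal action; $\mathrm{Sym}_0V=\mathbb{F}$. *)

theory Defs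
  imports
    "HOL-Analysis.Determinants"
    "HOL-Library.Poly_Mapping"
    "HOL-Library.Product_Plus"
    "HOL-Combinatorics.Permutations"
begin

section \<open>Free vector spaces\<close>

text \<open>
  Every representation below is presented as a subrepresentation of a free vector space
  \<open>k\<^sup>(\<^sup>I\<^sup>)\<close>, realised as the type \<open>'i \<Rightarrow>\<^sub>0 'k\<close> with basis \<open>single i 1\<close>.
\<close>

abbreviation "lookup \<equiv> Poly_Mapping.lookup"
abbreviation "keys \<equiv> Poly_Mapping.keys"
abbreviation "single \<equiv> Poly_Mapping.single"

definition scl :: "'k::field \<Rightarrow> ('i \<Rightarrow>\<^sub>0 'k) \<Rightarrow> ('i \<Rightarrow>\<^sub>0 'k)"
  where "scl c = Poly_Mapping.map ((*) c)"

lemma lookup_scl [simp]: "lookup (scl c v) i = c * lookup v i"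
  by (simp add: scl_def Poly_Mapping.map.rep_eq when_def)

global_interpretation fs: vector_space "scl :: 'k::field \<Rightarrow> ('i \<Rightarrow>\<^sub>0 'k) \<Rightarrow> ('i \<Rightarrow>\<^sub>0 'k)"
  by unfold_locales (simp_all add: poly_mapping_eq_iff fun_eq_iff lookup_add algebra_simps)

definition lin_ext :: "('i \<Rightarrow> ('j \<Rightarrow>\<^sub>0 'k)) \<Rightarrow> ('i \<Rightarrow>\<^sub>0 'k) \<Rightarrow> ('j \<Rightarrow>\<^sub>0 'k::field)"
  where "lin_ext b v = (\<Sum>i\<in>keys v. scl (lookup v i) (b i))"


section \<open>Representations of the special linear group\<close>

definition SL2 :: "('k::field ^ 2 ^ 2) set"
  where "SL2 = {g. det g = 1}"

record (overloaded) ('k, 'i) sl2_rep =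
  space :: "('i \<Rightarrow>\<^sub>0 'k) set"
  act :: "'k ^ 2 ^ 2 \<Rightarrow> ('i \<Rightarrow>\<^sub>0 'k) \<Rightarrow> ('i \<Rightarrow>\<^sub>0 'k)"

text \<open>The action is required on the whole ambient free space; the carrier is an invariant subspace.\<close>

definition is_rep :: "('k::field, 'i) sl2_rep \<Rightarrow> bool"
  where "is_rep V \<longleftrightarrow>
    fs.subspace (space V) \<and>
    (\<forall>g\<in>SL2. Vector_Spaces.linear scl scl (act V g) \<and> act V g ` space V \<subseteq> space V) \<and>
    act V (mat 1) = id \<and>
    (\<forall>g\<in>SL2. \<forall>h\<in>SL2. act V (g ** h) = act V g \<circ> act V h)"

definition rep_iso :: "('k::field, 'i) sl2_rep \<Rightarrow> ('k, 'j) sl2_rep \<Rightarrow> bool"  (infix \<open>\<cong>\<^sub>S\<^sub>L\<close> 50)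
  where "V \<cong>\<^sub>S\<^sub>L W \<longleftrightarrow> is_rep V \<and> is_rep W \<and>
    (\<exists>\<phi>. bij_betw \<phi> (space V) (space W) \<and>
      (\<forall>u\<in>space V. \<forall>v\<in>space V. \<phi> (u + v) = \<phi> u + \<phi> v) \<and>
      (\<forall>c. \<forall>v\<in>space V. \<phi> (scl c v) = scl c (\<phi> v)) \<and>
      (\<forall>g\<in>SL2. \<forall>v\<in>space V. \<phi> (act V g v) = act W g (\<phi> v)))"


section \<open>Tensor products\<close>

lift_definition tensor :: "('i \<Rightarrow>\<^sub>0 'k::field) \<Rightarrow> ('j \<Rightarrow>\<^sub>0 'k) \<Rightarrow> ('i \<times> 'j \<Rightarrow>\<^sub>0 'k)"
  is "\<lambda>v w (i, j). v i * w j"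
proof -
  fix v :: "'i \<Rightarrow> 'k" and w :: "'j \<Rightarrow> 'k"
  assume "finite {x. v x \<noteq> 0}" "finite {x. w x \<noteq> 0}"
  then have "finite ({x. v x \<noteq> 0} \<times> {x. w x \<noteq> 0})" by simp
  then show "finite {x. (case x of (i, j) \<Rightarrow> v i * w j) \<noteq> 0}"
    by (rule rev_finite_subset) auto
qed

text \<open>
  The tensor product of \<open>k\<^sup>(\<^sup>I\<^sup>)\<close> and \<open>k\<^sup>(\<^sup>J\<^sup>)\<close> is \<open>k\<^sup>(\<^sup>I \<^sup>\<times> \<^sup>J\<^sup>)\<close>. Over a field, the tensor product of
  subspaces \<open>V\<close> and \<open>W\<close> embeds into it as the span of the pure tensors, and the linear map
  \<open>f \<otimes> h\<close> is determined by its values on the basis \<open>e\<^sub>i \<otimes> e\<^sub>j\<close>.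
\<close>

definition rep_tensor :: "('k::field, 'i) sl2_rep \<Rightarrow> ('k, 'j) sl2_rep \<Rightarrow> ('k, 'i \<times> 'j) sl2_rep"
    (infixl \<open>\<otimes>\<^sub>S\<^sub>L\<close> 70)
  where "V \<otimes>\<^sub>S\<^sub>L W =
    \<lparr>space = fs.span {tensor v w | v w. v \<in> space V \<and> w \<in> space W},
     act = (\<lambda>g. lin_ext (\<lambda>(i, j). tensor (act V g (single i 1)) (act W g (single j 1))))\<rparr>"

text \<open>
  Tensor powers: \<open>V\<^sup>\<otimes>\<^sup>R\<close> lives in the free space on words of length \<open>R\<close> over \<open>I\<close>, and
  \<open>tensor_list [v\<^sub>1, \<dots>, v\<^sub>R]\<close> is \<open>v\<^sub>1 \<otimes> \<dots> \<otimes> v\<^sub>R\<close>.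
\<close>

lift_definition tensor_list :: "('i \<Rightarrow>\<^sub>0 'k::field) list \<Rightarrow> ('i list \<Rightarrow>\<^sub>0 'k)"
  is "\<lambda>vs l. if length l = length vs then \<Prod>r<length vs. (vs ! r) (l ! r) else 0"
proof -
  fix vs :: "('i \<Rightarrow> 'k) list"
  assume *: "list_all (\<lambda>f. finite {x. f x \<noteq> 0}) vs"
  let ?A = "\<Union>f\<in>set vs. {x. f x \<noteq> 0}"
  have "finite ?A" using * by (auto simp: list_all_iff)
  then have "finite {l. set l \<subseteq> ?A \<and> length l = length vs}" by (rule finite_lists_length_eq)
  then show "finite {l. (if length l = length vs then \<Prod>r<length vs. (vs ! r) (l ! r) else 0) \<noteq> 0}"
  proof (rule rev_finite_subset)
    show "{l. (if length l = length vs then \<Prod>r<length vs. (vs ! r) (l ! r) else 0) \<noteq> 0}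
      \<subseteq> {l. set l \<subseteq> ?A \<and> length l = length vs}"
    proof (intro subsetI CollectI)
      fix l
      assume "l \<in> {l. (if length l = length vs then \<Prod>r<length vs. (vs ! r) (l ! r) else 0) \<noteq> 0}"
      then have l: "length l = length vs" "\<forall>r<length vs. (vs ! r) (l ! r) \<noteq> 0"
        by (simp_all split: if_split_asm)
      then have "\<forall>x\<in>set l. x \<in> ?A" by (metis (mono_tags, lifting) UN_iff in_set_conv_nth mem_Collect_eq)
      with l show "set l \<subseteq> ?A \<and> length l = length vs" by blast
    qed
  qed
qed

definition rep_tensor_power :: "nat \<Rightarrow> ('k::field, 'i) sl2_rep \<Rightarrow> ('k, 'i list) sl2_rep"
  where "rep_tensor_power R V =
    \<lparr>space = fs.span {tensor_list vs | vs. length vs = R \<and> set vs \<subseteq> space V},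
     act = (\<lambda>g. lin_ext (\<lambda>l. tensor_list (map (\<lambda>i. act V g (single i 1)) l)))\<rparr>"

text \<open>The inverse makes this a left action: the vector in position \<open>r\<close> moves to position \<open>\<sigma> r\<close>.\<close>

definition permute_tensor :: "(nat \<Rightarrow> nat) \<Rightarrow> ('i list \<Rightarrow>\<^sub>0 'k) \<Rightarrow> ('i list \<Rightarrow>\<^sub>0 'k::field)"
  where "permute_tensor \<sigma> = lin_ext (\<lambda>l. single (permute_list (inv \<sigma>) l) 1)"

definition Sym_low :: "nat \<Rightarrow> ('k::field, 'i) sl2_rep \<Rightarrow> ('k, 'i list) sl2_rep"
  where "Sym_low R V =
    \<lparr>space = {w \<in> space (rep_tensor_power R V).
                \<forall>\<sigma>. \<sigma> permutes {..<R} \<longrightarrow> permute_tensor \<sigma> w = w},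
     act = act (rep_tensor_power R V)\<rparr>"


section \<open>The natural representation and its upper symmetric powers\<close>

text \<open>Matrices act on column vectors; \<open>X\<close> and \<open>Y\<close> are the standard basis vectors.\<close>

definition natural_rep :: "('k::field, 2) sl2_rep"
  where "natural_rep = \<lparr>space = UNIV, act = (\<lambda>g. lin_ext (\<lambda>j. \<Sum>i\<in>UNIV. single i (g $ i $ j)))\<rparr>"

text \<open>
  The ring \<open>k[X, Y]\<close> is the type \<open>nat \<times> nat \<Rightarrow>\<^sub>0 'k\<close> with its convolution product,
  \<open>single (i, j) 1\<close> being the monomial \<open>X\<^sup>i Y\<^sup>j\<close>.
\<close>

definition subst_XY :: "'k::field ^ 2 ^ 2 \<Rightarrow> (nat \<times> nat \<Rightarrow>\<^sub>0 'k) \<Rightarrow> (nat \<times> nat \<Rightarrow>\<^sub>0 'k)"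
  where "subst_XY g = lin_ext (\<lambda>(i, j).
    (single (1, 0) (g $ 1 $ 1) + single (0, 1) (g $ 2 $ 1)) ^ i *
    (single (1, 0) (g $ 1 $ 2) + single (0, 1) (g $ 2 $ 2)) ^ j)"

definition Sym_up :: "nat \<Rightarrow> ('k::field, nat \<times> nat) sl2_rep"
  where "Sym_up d = \<lparr>space = {P. \<forall>(i, j)\<in>keys P. i + j = d}, act = subst_XY\<rparr>"


section \<open>Well-definedness\<close>

text \<open>All constructions yield representations, and tensor products of maps act as expected.\<close>

lemma linearI:
  assumes "\<And>u v. f (u + v) = f u + f v" "\<And>c v. f (scl c v) = scl c (f v)"
  shows "Vector_Spaces.linear scl scl f"
proof -
  have "module_hom scl scl f"
    by (simp add: module_hom_iff fs.module_axioms assms)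
  then show ?thesis by (simp add: module_hom_iff_linear)
qed

lemma linear_iff: "Vector_Spaces.linear scl scl f \<longleftrightarrow>
    (\<forall>u v. f (u + v) = f u + f v) \<and> (\<forall>c v. f (scl c v) = scl c (f v))"
  by (simp add: module_hom_iff_linear[symmetric] module_hom_iff fs.module_axioms)

lemma mult_if_distrib:
  "(if b then x else y) * (z::'a::semiring_1) = (if b then x * z else y * z)"
  "z * (if b then x else y) = (if b then z * x else z * y)"
  by simp_all

lemma lin_ext_superset:
  assumes "finite A" "keys v \<subseteq> A"
  shows "lin_ext b v = (\<Sum>i\<in>A. scl (lookup v i) (b i))"
  unfolding lin_ext_def
  by (rule sum.mono_neutral_left) (use assms in \<open>auto simp: in_keys_iff\<close>)

lemma lin_ext_add: "lin_ext b (u + v) = lin_ext b u + lin_ext b v"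
proof -
  let ?A = "keys u \<union> keys v"
  have "lin_ext b w = (\<Sum>i\<in>?A. scl (lookup w i) (b i))" if "w \<in> {u, v, u + v}" for w
    by (rule lin_ext_superset) (use that keys_add[of u v] in auto)
  then show ?thesis by (simp add: lookup_add fs.scale_left_distrib sum.distrib)
qed

lemma lin_ext_scl: "lin_ext b (scl c v) = scl c (lin_ext b v)"
proof -
  have "lin_ext b (scl c v) = (\<Sum>i\<in>keys v. scl (lookup (scl c v) i) (b i))"
    by (rule lin_ext_superset) (auto simp: in_keys_iff)
  then show ?thesis by (simp add: lin_ext_def fs.scale_sum_right)
qed

lemma linear_lin_ext: "Vector_Spaces.linear scl scl (lin_ext b)"
  by (intro linearI lin_ext_add lin_ext_scl)

lemma lin_ext_single [simp]: "lin_ext b (single i 1) = b i"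
  by (simp add: lin_ext_def)

lemma lin_ext_single_id [simp]: "lin_ext (\<lambda>i. single i 1) = id"
proof
  fix v :: "'i \<Rightarrow>\<^sub>0 'k::field"
  have "lookup (lin_ext (\<lambda>i. single i 1) v) j = lookup v j" for j
    by (simp add: lin_ext_def lookup_sum lookup_single when_def in_keys_iff mult_if_distrib
        cong: if_cong)
  then show "lin_ext (\<lambda>i. single i 1) v = id v" by (simp add: poly_mapping_eq_iff fun_eq_iff)
qed

lemma linear_0: "Vector_Spaces.linear scl scl f \<Longrightarrow> f 0 = 0"
  using linear_iff[of f] fs.scale_zero_left by metis

lemma linear_sum: "Vector_Spaces.linear scl scl f \<Longrightarrow> f (sum g A) = (\<Sum>a\<in>A. f (g a))"
  by (induction A rule: infinite_finite_induct) (auto simp: linear_0 linear_iff[of f])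

lemma linear_lin_ext_comp:
  assumes "Vector_Spaces.linear scl scl f"
  shows "f (lin_ext b v) = lin_ext (\<lambda>i. f (b i)) v"
  using assms by (simp add: lin_ext_def linear_sum) (simp add: linear_iff)

lemma linear_eq_lin_ext:
  assumes "Vector_Spaces.linear scl scl f"
  shows "f v = lin_ext (\<lambda>i. f (single i 1)) v"
  using linear_lin_ext_comp[OF assms, of "\<lambda>i. single i 1" v] by simp

lemma lin_ext_compI:
  assumes "\<And>i. b i = lin_ext c (b' i)"
  shows "lin_ext b = lin_ext c \<circ> lin_ext b'"
proof -
  have b: "b = (\<lambda>i. lin_ext c (b' i))" using assms by (rule ext)
  show ?thesis unfolding b by (simp add: fun_eq_iff linear_lin_ext_comp[OF linear_lin_ext])
qed

lemma linear_eqI: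
  assumes "Vector_Spaces.linear scl scl f" "Vector_Spaces.linear scl scl h"
    "\<And>i. f (single i 1) = h (single i 1)"
  shows "f = h"
  by (rule ext) (subst linear_eq_lin_ext[OF assms(1)], subst linear_eq_lin_ext[OF assms(2)],
      simp add: assms(3))

lemma linear_comp:
  assumes "Vector_Spaces.linear scl scl f" "Vector_Spaces.linear scl scl h"
  shows "Vector_Spaces.linear scl scl (\<lambda>v. f (h v))"
  using assms by (simp add: linear_iff)

lemma span_invariant:
  assumes "Vector_Spaces.linear scl scl f" "\<And>v. v \<in> S \<Longrightarrow> f v \<in> fs.span S"
  shows "f ` fs.span S \<subseteq> fs.span S"
proof
  fix w assume "w \<in> f ` fs.span S"
  then obtain v where v: "v \<in> fs.span S" "w = f v" by blast
  from v(1) have "f v \<in> fs.span S"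
  proof (induction rule: fs.span_induct_alt)
    case base
    show ?case by (simp add: linear_0[OF assms(1)] fs.span_zero)
  next
    case (step c x y)
    then show ?case using assms by (simp add: linear_iff fs.span_add fs.span_scale)
  qed
  with v show "w \<in> fs.span S" by simp
qed

lemma lookup_tensor [simp]: "lookup (tensor v w) (i, j) = lookup v i * lookup w j"
  by (simp add: tensor.rep_eq)

lemma linear_tensor_left: "Vector_Spaces.linear scl scl (\<lambda>v. tensor v w)"
  by (rule linearI) (auto simp: poly_mapping_eq_iff fun_eq_iff lookup_add algebra_simps)

lemma linear_tensor_right: "Vector_Spaces.linear scl scl (tensor v)"
  by (rule linearI) (auto simp: poly_mapping_eq_iff fun_eq_iff lookup_add algebra_simps)

lemma tensor_single [simp]: "tensor (single i 1) (single j 1) = single (i, j) 1"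
  by (auto simp: poly_mapping_eq_iff fun_eq_iff lookup_single when_def)

lemma tensor_map_tensor:
  assumes f: "Vector_Spaces.linear scl scl f" and h: "Vector_Spaces.linear scl scl h"
  shows "lin_ext (\<lambda>(i, j). tensor (f (single i 1)) (h (single j 1))) (tensor v w) = tensor (f v) (h w)"
proof -
  let ?T = "lin_ext (\<lambda>(i, j). tensor (f (single i 1)) (h (single j 1)))"
  have 1: "(\<lambda>w. ?T (tensor (single i 1) w)) = (\<lambda>w. tensor (f (single i 1)) (h w))" for i
    by (rule linear_eqI)
      (auto intro!: linear_comp[OF linear_lin_ext] linear_comp[OF linear_tensor_right] h
        linear_tensor_right)
  have "(\<lambda>v. ?T (tensor v w)) = (\<lambda>v. tensor (f v) (h w))"
    by (rule linear_eqI)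
      (auto intro!: linear_comp[OF linear_lin_ext] linear_comp[OF linear_tensor_left] f
        linear_tensor_left simp: fun_cong[OF 1])
  then show ?thesis by (rule fun_cong)
qed

lemma is_repD:
  assumes "is_rep V"
  shows "fs.subspace (space V)"
    "\<And>g. g \<in> SL2 \<Longrightarrow> Vector_Spaces.linear scl scl (act V g)"
    "\<And>g v. g \<in> SL2 \<Longrightarrow> v \<in> space V \<Longrightarrow> act V g v \<in> space V"
    "act V (mat 1) = id"
    "\<And>g h v. g \<in> SL2 \<Longrightarrow> h \<in> SL2 \<Longrightarrow> act V (g ** h) v = act V g (act V h v)"
  using assms by (auto simp: is_rep_def)

lemma is_rep_tensor:
  assumes V: "is_rep V" and W: "is_rep W"
  shows "is_rep (V \<otimes>\<^sub>S\<^sub>L W)"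
  unfolding is_rep_def
proof (intro conjI ballI)
  note * = tensor_map_tensor[OF is_repD(2)[OF V] is_repD(2)[OF W]]
  show "fs.subspace (space (V \<otimes>\<^sub>S\<^sub>L W))" by (simp add: rep_tensor_def)
  fix g :: "'a^2^2" assume g: "g \<in> SL2"
  show "Vector_Spaces.linear scl scl (act (V \<otimes>\<^sub>S\<^sub>L W) g)"
    by (simp add: rep_tensor_def linear_lin_ext)
  show "act (V \<otimes>\<^sub>S\<^sub>L W) g ` space (V \<otimes>\<^sub>S\<^sub>L W) \<subseteq> space (V \<otimes>\<^sub>S\<^sub>L W)"
  proof -
    have "act (V \<otimes>\<^sub>S\<^sub>L W) g t \<in> space (V \<otimes>\<^sub>S\<^sub>L W)"
      if "t \<in> {tensor v w | v w. v \<in> space V \<and> w \<in> space W}" for t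
      using that is_repD(3)[OF V g] is_repD(3)[OF W g]
      by (auto simp: rep_tensor_def *[OF g g] intro!: fs.span_base) blast
    then show ?thesis
      unfolding rep_tensor_def sl2_rep.simps by (intro span_invariant[OF linear_lin_ext])
  qed
  fix h :: "'a^2^2" assume h: "h \<in> SL2"
  show "act (V \<otimes>\<^sub>S\<^sub>L W) (g ** h) = act (V \<otimes>\<^sub>S\<^sub>L W) g \<circ> act (V \<otimes>\<^sub>S\<^sub>L W) h"
    unfolding rep_tensor_def sl2_rep.simps
    by (rule lin_ext_compI) (auto simp: *[OF g g] is_repD(5)[OF V g h] is_repD(5)[OF W g h])
next
  show "act (V \<otimes>\<^sub>S\<^sub>L W) (mat 1) = id"
    by (simp add: rep_tensor_def is_repD(4)[OF V] is_repD(4)[OF W] case_prod_unfold)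
qed

definition cons_tensor :: "('i \<Rightarrow>\<^sub>0 'k::field) \<Rightarrow> ('i list \<Rightarrow>\<^sub>0 'k) \<Rightarrow> ('i list \<Rightarrow>\<^sub>0 'k)"
  where "cons_tensor v w = lin_ext (\<lambda>(i, l). single (i # l) 1) (tensor v w)"

lemma linear_cons_tensor_left: "Vector_Spaces.linear scl scl (\<lambda>v. cons_tensor v w)"
  unfolding cons_tensor_def by (intro linear_comp[OF linear_lin_ext] linear_tensor_left)

lemma linear_cons_tensor_right: "Vector_Spaces.linear scl scl (cons_tensor v)"
  unfolding cons_tensor_def[abs_def] by (intro linear_comp[OF linear_lin_ext] linear_tensor_right)

lemma cons_tensor_single [simp]: "cons_tensor (single i 1) (single l 1) = single (i # l) 1"
  by (simp add: cons_tensor_def)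

lemma lookup_lin_ext_inj:
  assumes "inj f"
  shows "lookup (lin_ext (\<lambda>i. single (f i) 1) v) (f i) = lookup v i"
  by (simp add: lin_ext_def lookup_sum lookup_single when_def inj_eq[OF assms] in_keys_iff
      mult_if_distrib cong: if_cong)

lemma lookup_lin_ext_notin:
  assumes "j \<notin> range f"
  shows "lookup (lin_ext (\<lambda>i. single (f i) 1) v) j = 0"
  using assms by (auto simp: lin_ext_def lookup_sum lookup_single when_def intro!: sum.neutral)

lemma lookup_tensor_list: "lookup (tensor_list vs) l =
    (if length l = length vs then \<Prod>r<length vs. lookup (vs ! r) (l ! r) else 0)"
  by (simp add: tensor_list.rep_eq)

lemma tensor_list_Nil [simp]: "tensor_list [] = single [] 1"
  by (auto simp: poly_mapping_eq_iff fun_eq_iff lookup_tensor_list lookup_single when_def)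

lemma tensor_list_Cons [simp]: "tensor_list (v # vs) = cons_tensor v (tensor_list vs)"
proof -
  have inj: "inj (\<lambda>(i, l). i # l)" by (auto simp: inj_def)
  have eq: "cons_tensor v w = lin_ext (\<lambda>p. single ((\<lambda>(i, l). i # l) p) 1) (tensor v w)" for w
    by (simp add: cons_tensor_def case_prod_unfold)
  have "lookup (tensor_list (v # vs)) l = lookup (cons_tensor v (tensor_list vs)) l" for l
  proof (cases l)
    case Nil
    then show ?thesis
      by (simp add: eq lookup_tensor_list) (subst lookup_lin_ext_notin, auto)
  next
    case (Cons i m)
    have "lookup (cons_tensor v (tensor_list vs)) l = lookup v i * lookup (tensor_list vs) m"
      using lookup_lin_ext_inj[OF inj, of "tensor v (tensor_list vs)" "(i, m)"]
      by (simp only: eq Cons prod.case lookup_tensor)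
    then show ?thesis
      by (simp add: Cons lookup_tensor_list prod.lessThan_Suc_shift del: prod.lessThan_Suc)
  qed
  then show ?thesis by (simp add: poly_mapping_eq_iff fun_eq_iff)
qed

lemma tensor_list_single [simp]: "tensor_list (map (\<lambda>i. single i 1) l) = single l 1"
  by (induction l) simp_all

lemma power_map_tensor_list:
  assumes f: "Vector_Spaces.linear scl scl f"
  shows "lin_ext (\<lambda>l. tensor_list (map (\<lambda>i. f (single i 1)) l)) (tensor_list vs) =
    tensor_list (map f vs)"
proof (induction vs)
  case (Cons v vs)
  let ?T = "lin_ext (\<lambda>l. tensor_list (map (\<lambda>i. f (single i 1)) l))"
  have 1: "(\<lambda>w. ?T (cons_tensor (single i 1) w)) = (\<lambda>w. cons_tensor (f (single i 1)) (?T w))" for i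
    by (rule linear_eqI)
      (auto intro!: linear_comp[OF linear_lin_ext] linear_comp[OF linear_cons_tensor_right]
        linear_cons_tensor_right linear_lin_ext)
  have "(\<lambda>v. ?T (cons_tensor v w)) = (\<lambda>v. cons_tensor (f v) (?T w))" for w
    by (rule linear_eqI)
      (auto intro!: linear_comp[OF linear_lin_ext] linear_comp[OF linear_cons_tensor_left]
        linear_cons_tensor_left f simp: fun_cong[OF 1])
  from fun_cong[OF this] Cons show ?case by simp
qed simp

lemma is_rep_tensor_power:
  assumes V: "is_rep V"
  shows "is_rep (rep_tensor_power R V)"
  unfolding is_rep_def
proof (intro conjI ballI)
  note * = power_map_tensor_list[OF is_repD(2)[OF V]]
  show "fs.subspace (space (rep_tensor_power R V))" by (simp add: rep_tensor_power_def)
  fix g :: "'a^2^2" assume g: "g \<in> SL2"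
  show "Vector_Spaces.linear scl scl (act (rep_tensor_power R V) g)"
    by (simp add: rep_tensor_power_def linear_lin_ext)
  show "act (rep_tensor_power R V) g ` space (rep_tensor_power R V) \<subseteq> space (rep_tensor_power R V)"
  proof -
    have "act (rep_tensor_power R V) g t \<in> space (rep_tensor_power R V)"
      if t: "t \<in> {tensor_list vs | vs. length vs = R \<and> set vs \<subseteq> space V}" for t
    proof -
      from t obtain vs where vs: "t = tensor_list vs" "length vs = R" "set vs \<subseteq> space V" by blast
      have "set (map (act V g) vs) \<subseteq> space V" using vs is_repD(3)[OF V g] by auto
      then show ?thesis
        using vs(2) unfolding rep_tensor_power_def vs(1)
        by (simp add: *[OF g]) (rule fs.span_base, rule CollectI, rule exI[of _ "map (act V g) vs"], simp)
    qed
    then show ?thesis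
      unfolding rep_tensor_power_def sl2_rep.simps by (intro span_invariant[OF linear_lin_ext])
  qed
  fix h :: "'a^2^2" assume h: "h \<in> SL2"
  show "act (rep_tensor_power R V) (g ** h) = act (rep_tensor_power R V) g \<circ> act (rep_tensor_power R V) h"
    unfolding rep_tensor_power_def sl2_rep.simps
    by (rule lin_ext_compI) (simp add: *[OF g] is_repD(5)[OF V g h] comp_def)
next
  show "act (rep_tensor_power R V) (mat 1) = id"
    by (simp add: rep_tensor_power_def is_repD(4)[OF V])
qed

lemma permute_tensor_tensor_list:
  assumes s: "\<sigma> permutes {..<length vs}"
  shows "permute_tensor \<sigma> (tensor_list vs) = tensor_list (permute_list (inv \<sigma>) vs)"
proof -
  let ?n = "length vs"
  have s': "inv \<sigma> permutes {..<?n}" using s by (rule permutes_inv)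
  have keys: "length l = ?n" if "l \<in> keys (tensor_list vs)" for l
    using that by (auto simp: in_keys_iff lookup_tensor_list split: if_splits)
  have perm: "permute_list (inv \<sigma>) l = m \<longleftrightarrow> l = permute_list \<sigma> m"
    if "length l = ?n" "length m = ?n" for l m :: "'a list"
    using that permute_list_compose[of \<sigma> l "inv \<sigma>"] permute_list_compose[of "inv \<sigma>" m \<sigma>] s s'
    by (auto simp: permutes_inv_o[OF s])
  have "lookup (permute_tensor \<sigma> (tensor_list vs)) m =
      lookup (tensor_list (permute_list (inv \<sigma>) vs)) m" for m
  proof (cases "length m = ?n")
    case False
    then have "permute_list (inv \<sigma>) l \<noteq> m" if "l \<in> keys (tensor_list vs)" for l
      using keys[OF that] by auto
    with False show ?thesis
      by (auto simp: permute_tensor_def lin_ext_def lookup_sum lookup_single when_def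
          lookup_tensor_list intro!: sum.neutral)
  next
    case True
    have "lookup (permute_tensor \<sigma> (tensor_list vs)) m =
        (\<Sum>l\<in>keys (tensor_list vs). if l = permute_list \<sigma> m then lookup (tensor_list vs) l else 0)"
      unfolding permute_tensor_def lin_ext_def lookup_sum
      by (rule sum.cong) (auto simp: lookup_single when_def perm keys True)
    also have "\<dots> = lookup (tensor_list vs) (permute_list \<sigma> m)"
      by (simp add: in_keys_iff)
    also have "\<dots> = (\<Prod>r<?n. lookup (vs ! r) (m ! \<sigma> r))"
      using True s by (simp add: lookup_tensor_list permute_list_nth)
    also have "\<dots> = (\<Prod>r<?n. lookup (vs ! inv \<sigma> r) (m ! r))"
      using prod.permute[OF s', of "\<lambda>r. lookup (vs ! r) (m ! \<sigma> r)"]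
      by (simp add: comp_def permutes_inverses[OF s])
    also have "\<dots> = lookup (tensor_list (permute_list (inv \<sigma>) vs)) m"
      using True s' by (simp add: lookup_tensor_list permute_list_nth)
    finally show ?thesis .
  qed
  then show ?thesis by (simp add: poly_mapping_eq_iff fun_eq_iff)
qed

lemma linear_permute_tensor: "Vector_Spaces.linear scl scl (permute_tensor \<sigma>)"
  unfolding permute_tensor_def by (rule linear_lin_ext)

lemma linear_eq_on_span:
  assumes "Vector_Spaces.linear scl scl f" "Vector_Spaces.linear scl scl h"
    "\<And>v. v \<in> S \<Longrightarrow> f v = h v" "v \<in> fs.span S"
  shows "f v = h v"
  using assms(4)
proof (induction rule: fs.span_induct_alt)
  case base
  show ?case using assms by (simp add: linear_0)
next
  case (step c x y)
  then show ?case using assms by (simp add: linear_iff)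
qed

lemma is_rep_Sym_low:
  assumes V: "is_rep V"
  shows "is_rep (Sym_low R V)"
proof -
  let ?P = "rep_tensor_power R V"
  have P: "is_rep ?P" using V by (rule is_rep_tensor_power)
  have comm: "permute_tensor \<sigma> (act ?P g w) = act ?P g (permute_tensor \<sigma> w)"
    if g: "g \<in> SL2" and s: "\<sigma> permutes {..<R}" and w: "w \<in> space ?P" for g \<sigma> w
  proof (rule linear_eq_on_span[where f = "\<lambda>w. permute_tensor \<sigma> (act ?P g w)"
        and h = "\<lambda>w. act ?P g (permute_tensor \<sigma> w)"])
    show "Vector_Spaces.linear scl scl (\<lambda>w. permute_tensor \<sigma> (act ?P g w))"
      "Vector_Spaces.linear scl scl (\<lambda>w. act ?P g (permute_tensor \<sigma> w))"
      by (rule linear_comp[OF linear_permute_tensor is_repD(2)[OF P g]]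
          linear_comp[OF is_repD(2)[OF P g] linear_permute_tensor])+
    show "w \<in> fs.span {tensor_list vs | vs. length vs = R \<and> set vs \<subseteq> space V}"
      using w by (simp add: rep_tensor_power_def)
    show "permute_tensor \<sigma> (act ?P g v) = act ?P g (permute_tensor \<sigma> v)"
      if "v \<in> {tensor_list vs | vs. length vs = R \<and> set vs \<subseteq> space V}" for v
    proof -
      from that obtain vs where vs: "v = tensor_list vs" "length vs = R" by blast
      have "permute_list (inv \<sigma>) (map (act V g) vs) = map (act V g) (permute_list (inv \<sigma>) vs)"
        using s vs by (intro permute_list_map permutes_inv) simp
      then show ?thesis
        using s vs by (simp add: rep_tensor_power_def power_map_tensor_list[OF is_repD(2)[OF V g]]
            permute_tensor_tensor_list)
    qed
  qed
  show ?thesis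
    unfolding is_rep_def
  proof (intro conjI ballI)
    show "fs.subspace (space (Sym_low R V))"
    proof -
      have "permute_tensor \<sigma> 0 = (0 :: 'b list \<Rightarrow>\<^sub>0 'a)"
        "permute_tensor \<sigma> (u + v) = permute_tensor \<sigma> u + permute_tensor \<sigma> v"
        "permute_tensor \<sigma> (scl c v) = scl c (permute_tensor \<sigma> v)"
        for \<sigma> c and u v :: "'b list \<Rightarrow>\<^sub>0 'a"
        using linear_permute_tensor[of \<sigma>] linear_0[OF linear_permute_tensor] unfolding linear_iff by blast+
      with is_repD(1)[OF P] show ?thesis by (auto simp: Sym_low_def fs.subspace_def)
    qed
    show "act (Sym_low R V) (mat 1) = id"
      using is_repD(4)[OF P] by (simp add: Sym_low_def)
    fix g :: "'a^2^2" assume g: "g \<in> SL2"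
    show "Vector_Spaces.linear scl scl (act (Sym_low R V) g)"
      using is_repD(2)[OF P g] by (simp add: Sym_low_def)
    show "act (Sym_low R V) g ` space (Sym_low R V) \<subseteq> space (Sym_low R V)"
      using is_repD(3)[OF P g] comm[OF g] by (auto simp: Sym_low_def)
    fix h :: "'a^2^2" assume h: "h \<in> SL2"
    show "act (Sym_low R V) (g ** h) = act (Sym_low R V) g \<circ> act (Sym_low R V) h"
      using is_repD(5)[OF P g h] by (simp add: Sym_low_def fun_eq_iff)
  qed
qed

lemma is_rep_natural_rep: "is_rep natural_rep"
  unfolding is_rep_def
proof (intro conjI ballI)
  show "fs.subspace (space natural_rep)" by (simp add: natural_rep_def)
  have "(\<Sum>i\<in>UNIV. single i (mat 1 $ i $ j)) = single j (1::'a)" for j :: 2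
    by (simp add: poly_mapping_eq_iff fun_eq_iff lookup_sum lookup_single when_def mat_def)
  then show "act natural_rep (mat 1) = (id :: (2 \<Rightarrow>\<^sub>0 'a) \<Rightarrow> _)" by (simp add: natural_rep_def)
  fix g :: "'a^2^2"
  show "Vector_Spaces.linear scl scl (act natural_rep g)" by (simp add: natural_rep_def linear_lin_ext)
  show "act natural_rep g ` space natural_rep \<subseteq> space natural_rep" by (simp add: natural_rep_def)
  fix h :: "'a^2^2"
  have single_scl: "single i c = scl c (single i 1)" for i :: 2 and c :: 'a
    by (simp add: poly_mapping_eq_iff fun_eq_iff lookup_single when_def)
  have *: "act natural_rep g (single i c) = scl c (\<Sum>k\<in>UNIV. single k (g $ k $ i))" for i c
    by (subst single_scl) (simp add: natural_rep_def lin_ext_scl)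
  show "act natural_rep (g ** h) = act natural_rep g \<circ> act natural_rep h"
  proof -
    have "(\<Sum>i\<in>UNIV. single i ((g ** h) $ i $ j)) =
        act natural_rep g (\<Sum>i\<in>UNIV. single i (h $ i $ j))" for j
    proof -
      have "act natural_rep g (\<Sum>i\<in>UNIV. single i (h $ i $ j)) =
          (\<Sum>i\<in>UNIV. act natural_rep g (single i (h $ i $ j)))"
        by (simp add: natural_rep_def linear_sum[OF linear_lin_ext])
      also have "\<dots> = (\<Sum>i\<in>UNIV. single i ((g ** h) $ i $ j))"
        unfolding * by (simp add: poly_mapping_eq_iff fun_eq_iff lookup_add lookup_single
          when_def matrix_matrix_mult_def sum_2 algebra_simps)
      finally show ?thesis by simp
    qed
    then show ?thesis
      unfolding natural_rep_def sl2_rep.simps by (rule lin_ext_compI)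
  qed
qed

lemma scl_eq_mult: "scl c p = single 0 c * (p :: nat \<times> nat \<Rightarrow>\<^sub>0 'k::field)"
  by (simp add: scl_def mult_map_scale_conv_mult)

lemma linear_mult_right: "Vector_Spaces.linear scl scl (\<lambda>p. p * (q :: nat \<times> nat \<Rightarrow>\<^sub>0 'k::field))"
  by (rule linearI) (simp_all add: scl_eq_mult algebra_simps)

lemma linear_mult_left: "Vector_Spaces.linear scl scl ((*) (p :: nat \<times> nat \<Rightarrow>\<^sub>0 'k::field))"
  by (rule linearI) (simp_all add: scl_eq_mult algebra_simps)

lemma linear_subst_XY: "Vector_Spaces.linear scl scl (subst_XY g)"
  unfolding subst_XY_def by (rule linear_lin_ext)

lemma subst_XY_single: "subst_XY g (single (i, j) 1) =
    (single (1, 0) (g $ 1 $ 1) + single (0, 1) (g $ 2 $ 1)) ^ i *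
    (single (1, 0) (g $ 1 $ 2) + single (0, 1) (g $ 2 $ 2)) ^ j"
  by (simp add: subst_XY_def)

lemma subst_XY_mult: "subst_XY g (p * q) = subst_XY g p * subst_XY g q"
proof -
  have 0: "subst_XY g (single i 1 * single j 1) = subst_XY g (single i 1) * subst_XY g (single j 1)"
    for i j
    by (cases i; cases j) (simp only: mult_single subst_XY_single power_add mult_ac mult_1 add_Pair)
  have 1: "(\<lambda>q. subst_XY g (single i 1 * q)) = (\<lambda>q. subst_XY g (single i 1) * subst_XY g q)" for i
    by (rule linear_eqI[OF linear_comp[OF linear_subst_XY linear_mult_left]
          linear_comp[OF linear_mult_left linear_subst_XY]]) (rule 0)
  have "(\<lambda>p. subst_XY g (p * q)) = (\<lambda>p. subst_XY g p * subst_XY g q)"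
    by (rule linear_eqI[OF linear_comp[OF linear_subst_XY linear_mult_right]
          linear_comp[OF linear_mult_right linear_subst_XY]]) (rule fun_cong[OF 1])
  then show ?thesis by (rule fun_cong)
qed

lemma subst_XY_1: "subst_XY g 1 = 1"
proof -
  have "subst_XY g (single (0, 0) 1) = 1" by (simp only: subst_XY_single power_0 mult_1)
  then show ?thesis by (metis single_one zero_prod_def)
qed

lemma subst_XY_power: "subst_XY g (p ^ n) = subst_XY g p ^ n"
  by (induction n) (simp_all add: subst_XY_1 subst_XY_mult)

lemma subst_XY_matrix_mult: "subst_XY (g ** h) p = subst_XY g (subst_XY h p)"
proof -
  have single_scl: "single m c = scl c (single m 1)" for m :: "nat \<times> nat" and c :: 'a
    by (simp add: poly_mapping_eq_iff fun_eq_iff lookup_single when_def)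
  have X: "subst_XY g (single (1, 0) c) = scl c (single (1, 0) (g $ 1 $ 1) + single (0, 1) (g $ 2 $ 1))"
    and Y: "subst_XY g (single (0, 1) c) = scl c (single (1, 0) (g $ 1 $ 2) + single (0, 1) (g $ 2 $ 2))"
    for c
    using linear_subst_XY[of g] subst_XY_single[of g 1 0] subst_XY_single[of g 0 1]
    by (subst single_scl, simp add: linear_iff)+
  have "subst_XY g (single (1, 0) a + single (0, 1) b) =
      single (1, 0) (g $ 1 $ 1 * a + g $ 1 $ 2 * b) + single (0, 1) (g $ 2 $ 1 * a + g $ 2 $ 2 * b)"
    for a b
  proof -
    have "subst_XY g (single (1, 0) a + single (0, 1) b) =
        subst_XY g (single (1, 0) a) + subst_XY g (single (0, 1) b)"
      using linear_subst_XY[of g] unfolding linear_iff by blast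
    then show ?thesis
      unfolding X Y
      by (auto simp: poly_mapping_eq_iff fun_eq_iff lookup_add lookup_single when_def algebra_simps)
  qed
  then have "subst_XY (g ** h) = (\<lambda>p. subst_XY g (subst_XY h p))"
    by (intro linear_eqI linear_comp[OF linear_subst_XY linear_subst_XY] linear_subst_XY)
      (simp add: split_paired_all subst_XY_single subst_XY_mult subst_XY_power
        matrix_matrix_mult_def sum_2)
  then show ?thesis by (rule fun_cong)
qed

lemma Sym_up_mult:
  assumes "p \<in> space (Sym_up m)" "q \<in> space (Sym_up n)"
  shows "p * q \<in> space (Sym_up (m + n))"
proof -
  have "i + j = m + n" if "(i, j) \<in> keys (p * q)" for i j
  proof -
    from that keys_mult[of p q] obtain a b where ab: "(i, j) = a + b" "a \<in> keys p" "b \<in> keys q"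
      by blast
    with assms show ?thesis by (cases a; cases b) (fastforce simp: Sym_up_def)
  qed
  then show ?thesis by (auto simp: Sym_up_def)
qed

lemma Sym_up_power:
  assumes "p \<in> space (Sym_up 1)"
  shows "p ^ n \<in> space (Sym_up n)"
proof (induction n)
  case 0
  show ?case by (auto simp: Sym_up_def zero_prod_def)
next
  case (Suc n)
  then show ?case using Sym_up_mult[OF assms Suc] by simp
qed

lemma subspace_Sym_up: "fs.subspace (space (Sym_up d))"
  unfolding fs.subspace_def
proof (intro conjI ballI allI)
  fix p q :: "nat \<times> nat \<Rightarrow>\<^sub>0 'a" and c :: 'a
  assume p: "p \<in> space (Sym_up d)"
  then show "scl c p \<in> space (Sym_up d)"
    by (auto simp: Sym_up_def in_keys_iff)
  assume "q \<in> space (Sym_up d)"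
  with p show "p + q \<in> space (Sym_up d)"
    using keys_add[of p q] by (auto simp: Sym_up_def)
qed (simp add: Sym_up_def)

lemma is_rep_Sym_up: "is_rep (Sym_up d)"
  unfolding is_rep_def
proof (intro conjI ballI)
  show "fs.subspace (space (Sym_up d))" by (rule subspace_Sym_up)
  have "(\<lambda>p. subst_XY (mat 1) p) = (\<lambda>p :: nat \<times> nat \<Rightarrow>\<^sub>0 'a. p)"
  proof (rule linear_eqI)
    have X: "single (1, 0) (1::'a) ^ i = single (i, 0) 1" for i :: nat
      by (induction i) (simp_all add: mult_single flip: zero_prod_def)
    have Y: "single (0, 1) (1::'a) ^ i = single (0, i) 1" for i :: nat
      by (induction i) (simp_all add: mult_single flip: zero_prod_def)
    show "subst_XY (mat 1) (single m 1) = single m (1::'a)" for m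
      by (cases m) (simp add: subst_XY_single mat_def X[simplified] Y[simplified] mult_single)
  qed (auto intro: linear_subst_XY linearI)
  then show "act (Sym_up d) (mat 1) = (id :: (nat \<times> nat \<Rightarrow>\<^sub>0 'a) \<Rightarrow> _)"
    by (simp add: Sym_up_def fun_eq_iff)
  fix g :: "'a^2^2"
  show "Vector_Spaces.linear scl scl (act (Sym_up d) g)"
    by (simp add: Sym_up_def linear_subst_XY)
  show "act (Sym_up d) g ` space (Sym_up d) \<subseteq> space (Sym_up d)"
  proof safe
    fix p :: "nat \<times> nat \<Rightarrow>\<^sub>0 'a" assume p: "p \<in> space (Sym_up d)"
    have lin: "single (1, 0) a + single (0, 1) b \<in> space (Sym_up 1)" for a b :: 'a
      using keys_add[of "single (1, 0) a" "single (0, 1) b"]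
      by (auto simp: Sym_up_def simp del: One_nat_def split: if_splits)
    have "subst_XY g p = (\<Sum>m\<in>keys p. scl (lookup p m) (subst_XY g (single m 1)))"
      by (subst linear_eq_lin_ext[OF linear_subst_XY]) (simp add: lin_ext_def)
    also have "\<dots> \<in> space (Sym_up d)"
    proof (intro fs.subspace_sum[OF subspace_Sym_up] fs.subspace_scale[OF subspace_Sym_up])
      fix m assume m: "m \<in> keys p"
      obtain i j where ij: "m = (i, j)" by fastforce
      with m p have "d = i + j" by (auto simp: Sym_up_def)
      then show "subst_XY g (single m 1) \<in> space (Sym_up d)"
        unfolding ij subst_XY_single by (simp only: Sym_up_mult Sym_up_power lin)
    qed
    finally show "act (Sym_up d) g p \<in> space (Sym_up d)" by (simp add: Sym_up_def)
  qed
  fix h :: "'a^2^2"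
  show "act (Sym_up d) (g ** h) = act (Sym_up d) g \<circ> act (Sym_up d) h"
    by (simp add: Sym_up_def fun_eq_iff subst_XY_matrix_mult)
qed

end

theory Submission
  imports Defs "HOL-Computational_Algebra.Polynomial"
begin

text \<open>
  \<open>Sym\<^sub>R Sym\<^sup>d E\<close> is the space of symmetric polynomials in \<open>R\<close> points of \<open>E\<close> that are homogeneous of
  degree \<open>d\<close> in each point, and \<open>Sym\<^sub>R E\<close> is the case \<open>d = 1\<close>. All three isomorphisms are given by
  specialising points, which commutes with the group action:
  (i) is inverse to \<open>g(W; Z\<^sub>0, \<dots>, Z\<^sub>K) \<mapsto> g(Z\<^sub>0; Z\<^sub>0, \<dots>, Z\<^sub>K)\<close>,
  (ii) is \<open>g(W\<^sub>1, \<dots>, W\<^sub>K; Z\<^sub>0, \<dots>, Z\<^sub>K) \<mapsto> g(Z\<^sub>1, \<dots>, Z\<^sub>K; Z\<^sub>0, \<dots>, Z\<^sub>K)\<close>, and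
  (iii) fills the last \<open>K\<close> of the \<open>d + K\<close> points of the first factor with \<open>Z\<^sub>1, \<dots>, Z\<^sub>K\<close>.
  If the image of \<open>g\<close> vanishes, then by symmetry \<open>g\<close> vanishes whenever \<open>n\<close> of its points (in which it
  has degree at most \<open>e\<close>) are distinct members of the remaining \<open>n + e\<close> points; interpolating one
  point at a time gives \<open>g = 0\<close>. Source and target have the same dimension, so the maps are bijective.
\<close>

section \<open>Vectors with coefficients constant on classes of basis elements: basis, dimension,
  tensor product\<close>

section \<open>Spaces of functions constant on classes\<close>

text \<open>One description serves every space below: \<open>r = id\<close> gives all vectors
  supported on \<open>S\<close>, \<open>r = mset\<close> on words gives the symmetric tensors, and
  \<open>map_prod\<close> of two such maps gives the tensor product. For finite \<open>S\<close> the
  dimension is the number of classes.\<close>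

definition class_functions :: "'i set \<Rightarrow> ('i \<Rightarrow> 'c) \<Rightarrow> ('i \<Rightarrow>\<^sub>0 'k::field) set"
  where "class_functions S r = {v. keys v \<subseteq> S \<and> (\<forall>i\<in>S. \<forall>j\<in>S. r i = r j \<longrightarrow> lookup v i = lookup v j)}"

text \<open>For \<open>r = mset\<close> these are orbit sums under permutation of positions. Unlike
  averages over the symmetric group they involve no division, so they form a basis in every
  characteristic.\<close>

definition class_sum :: "'i set \<Rightarrow> ('i \<Rightarrow> 'c) \<Rightarrow> 'c \<Rightarrow> ('i \<Rightarrow>\<^sub>0 'k::field)"
  where "class_sum S r c = (\<Sum>i\<in>{i\<in>S. r i = c}. single i 1)"

lemma lookup_class_sum:
  "finite S \<Longrightarrow> lookup (class_sum S r c) i = (if i \<in> S \<and> r i = c then 1 else 0)"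
  by (simp add: class_sum_def lookup_sum lookup_single when_def)

lemma class_functionsI:
  assumes "\<And>i. i \<notin> S \<Longrightarrow> lookup v i = 0"
    "\<And>i j. i \<in> S \<Longrightarrow> j \<in> S \<Longrightarrow> r i = r j \<Longrightarrow> lookup v i = lookup v j"
  shows "v \<in> class_functions S r"
  unfolding class_functions_def in_keys_iff subset_iff using assms by blast

lemma class_functionsD:
  assumes "v \<in> class_functions S r"
  shows "i \<notin> S \<Longrightarrow> lookup v i = 0"
    "i \<in> S \<Longrightarrow> j \<in> S \<Longrightarrow> r i = r j \<Longrightarrow> lookup v i = lookup v j"
  using assms unfolding class_functions_def in_keys_iff subset_iff by blast+

lemma subspace_class_functions: "fs.subspace (class_functions S r :: ('i \<Rightarrow>\<^sub>0 'k::field) set)"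
  unfolding fs.subspace_def
proof (intro conjI ballI allI)
  show "0 \<in> class_functions S r" by (simp add: class_functions_def)
  fix u :: "'i \<Rightarrow>\<^sub>0 'k" assume u: "u \<in> class_functions S r"
  show "scl c u \<in> class_functions S r" for c :: 'k
    by (rule class_functionsI; simp) (use class_functionsD[OF u] in blast)+
  fix v :: "'i \<Rightarrow>\<^sub>0 'k" assume v: "v \<in> class_functions S r"
  show "u + v \<in> class_functions S r"
    by (rule class_functionsI; simp only: lookup_add) (use class_functionsD[OF u] class_functionsD[OF v] in \<open>metis add_0\<close>)+
qed

lemma class_sum_in_class_functions: "finite S \<Longrightarrow> class_sum S r c \<in> class_functions S r"
  by (rule class_functionsI) (auto simp: lookup_class_sum)

text \<open>The coefficient is constant on each class, so it may be read off at the representative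
  chosen by \<open>inv_into\<close>.\<close>

lemma class_functions_expansion:
  assumes S: "finite S" and v: "v \<in> class_functions S r"
  shows "v = (\<Sum>c\<in>r ` S. scl (lookup v (inv_into S r c)) (class_sum S r c))"
proof (rule poly_mapping_eqI)
  fix i
  have "lookup (\<Sum>c\<in>r ` S. scl (lookup v (inv_into S r c)) (class_sum S r c)) i =
      (\<Sum>c\<in>r ` S. if c = r i then (if i \<in> S then lookup v (inv_into S r c) else 0) else 0)"
    unfolding lookup_sum by (rule sum.cong) (auto simp: lookup_class_sum[OF S])
  also have "\<dots> = (if i \<in> S then lookup v (inv_into S r (r i)) else 0)"
    using S by (simp add: sum.delta)
  also have "\<dots> = lookup v i"
    using class_functionsD(1)[OF v, of i] class_functionsD(2)[OF v, of "inv_into S r (r i)" i]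
    by (auto simp: inv_into_into f_inv_into_f)
  finally show "lookup v i =
      lookup (\<Sum>c\<in>r ` S. scl (lookup v (inv_into S r c)) (class_sum S r c)) i" by simp
qed

lemma span_class_sums:
  assumes "finite S"
  shows "fs.span (class_sum S r ` (r ` S)) = class_functions S r"
proof
  show "fs.span (class_sum S r ` (r ` S)) \<subseteq> class_functions S r"
    by (rule fs.span_minimal) (auto intro: class_sum_in_class_functions assms subspace_class_functions)
  show "class_functions S r \<subseteq> fs.span (class_sum S r ` (r ` S))"
  proof
    fix v assume v: "v \<in> class_functions S r"
    show "v \<in> fs.span (class_sum S r ` (r ` S))"
      by (subst class_functions_expansion[OF assms v]) (intro fs.span_sum fs.span_scale fs.span_base imageI)
  qed
qed

lemma inj_on_class_sum:
  assumes "finite S"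
  shows "inj_on (class_sum S r :: _ \<Rightarrow> _ \<Rightarrow>\<^sub>0 'k::field) (r ` S)"
proof (rule inj_onI)
  fix c c' assume "c \<in> r ` S" and eq: "class_sum S r c = (class_sum S r c' :: _ \<Rightarrow>\<^sub>0 'k)"
  then obtain i where i: "i \<in> S" "r i = c" by auto
  with arg_cong[OF eq, of "\<lambda>v. lookup v i"] show "c = c'"
    by (simp add: lookup_class_sum[OF assms] split: if_splits)
qed

lemma independent_class_sums:
  assumes S: "finite S"
  shows "fs.independent (class_sum S r ` (r ` S) :: ('i \<Rightarrow>\<^sub>0 'k::field) set)"
proof
  let ?B = "class_sum S r ` (r ` S) :: ('i \<Rightarrow>\<^sub>0 'k) set"
  assume "fs.dependent ?B"
  then obtain u v where u: "v \<in> ?B" "u v \<noteq> 0" "(\<Sum>v\<in>?B. scl (u v) v) = 0"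
    using S by (auto simp: fs.dependent_finite)
  from u(1) obtain i where i: "i \<in> S" "v = class_sum S r (r i)" by auto
  have "0 = lookup (\<Sum>c\<in>r ` S. scl (u (class_sum S r c)) (class_sum S r c)) i"
    using u(3) by (simp add: sum.reindex[OF inj_on_class_sum[OF S]])
  also have "\<dots> = (\<Sum>c\<in>r ` S. if c = r i then u (class_sum S r c) else 0)"
    unfolding lookup_sum by (rule sum.cong) (auto simp: lookup_class_sum[OF S] i)
  also have "\<dots> = u v" using S i by (simp add: sum.delta)
  finally show False using u(2) by simp
qed

text \<open>Dimension count: the class sums of the source go to an independent set with as many
  elements as the basis of the target, hence to a spanning set.\<close>

lemma linear_inj_on_class_functions_surj:
  assumes S: "finite S" and T: "finite T" and card: "card (r ` S) = card (s ` T)"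
    and f: "Vector_Spaces.linear scl scl f"
    and im: "f ` class_functions S r \<subseteq> class_functions T s"
    and inj: "inj_on f (class_functions S r :: ('i \<Rightarrow>\<^sub>0 'k::field) set)"
  shows "f ` class_functions S r = class_functions T s"
proof (rule antisym[OF im])
  let ?B = "class_sum S r ` (r ` S) :: ('i \<Rightarrow>\<^sub>0 'k) set"
  let ?C = "class_sum T s ` (s ` T) :: (_ \<Rightarrow>\<^sub>0 'k) set"
  interpret f: Vector_Spaces.linear scl scl f by (rule f)
  have B: "fs.span ?B = class_functions S r" and C: "fs.span ?C = class_functions T s"
    using S T by (simp_all add: span_class_sums)
  have ind: "fs.independent (f ` ?B)"
    by (rule f.independent_injective_image)
      (use inj in \<open>simp_all add: B independent_class_sums[OF S]\<close>)
  have "inj_on f ?B"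
    by (rule inj_on_subset[OF inj]) (auto intro: class_sum_in_class_functions S)
  then have cardB: "card (f ` ?B) = card (s ` T)"
    by (simp add: card_image inj_on_class_sum[OF S] card)
  have cardC: "card ?C = card (s ` T)"
    by (simp add: card_image inj_on_class_sum[OF T])
  have sub: "f ` ?B \<subseteq> fs.span ?C"
    unfolding C using im B fs.span_superset[of ?B] by blast
  \<comment> \<open>A basis vector outside this span could be added to the image of
    \<open>?B\<close>, giving an independent subset of the span of \<open>?C\<close> larger than
    \<open>?C\<close>.\<close>
  have "?C \<subseteq> fs.span (f ` ?B)"
  proof (rule ccontr)
    assume "\<not> ?C \<subseteq> fs.span (f ` ?B)"
    then obtain c where c: "c \<in> ?C" "c \<notin> fs.span (f ` ?B)" by blast
    have "fs.independent (insert c (f ` ?B))"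
      using ind c(2) by (rule fs.independent_insertI[rotated])
    moreover have "insert c (f ` ?B) \<subseteq> fs.span ?C"
      using sub c(1) fs.span_superset[of ?C] by blast
    ultimately have "card (insert c (f ` ?B)) \<le> card ?C"
      using fs.independent_span_bound[of ?C] T by blast
    moreover have "c \<notin> f ` ?B" using c(2) fs.span_superset[of "f ` ?B"] by blast
    ultimately show False using S cardB cardC by simp
  qed
  then have "fs.span ?C \<subseteq> fs.span (f ` ?B)"
    by (rule fs.span_minimal[OF _ fs.subspace_span])
  then show "class_functions T s \<subseteq> f ` class_functions S r" by (simp add: C B f.span_image)
qed

text \<open>A class of the product is a product of classes, so its class sum is a pure tensor of
  class sums.\<close>

lemma span_tensor_class_functions:
  assumes S: "finite S" and T: "finite T"
  shows "fs.span {tensor v w | v w. v \<in> class_functions S r \<and> w \<in> class_functions T s} =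
    (class_functions (S \<times> T) (map_prod r s) :: ('i \<times> 'j \<Rightarrow>\<^sub>0 'k::field) set)" (is "fs.span ?P = _")
proof
  show "fs.span ?P \<subseteq> class_functions (S \<times> T) (map_prod r s)"
  proof (rule fs.span_minimal[OF _ subspace_class_functions], safe)
    fix v :: "'i \<Rightarrow>\<^sub>0 'k" and w :: "'j \<Rightarrow>\<^sub>0 'k" assume v: "v \<in> class_functions S r" and w: "w \<in> class_functions T s"
    show "tensor v w \<in> class_functions (S \<times> T) (map_prod r s)"
      by (rule class_functionsI; clarsimp) (use class_functionsD[OF v] class_functionsD[OF w] in metis)+
  qed
  have *: "class_sum (S \<times> T) (map_prod r s) (c, d) = tensor (class_sum S r c) (class_sum T s d :: _ \<Rightarrow>\<^sub>0 'k)"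
    for c d using S T by (auto intro!: poly_mapping_eqI simp: lookup_class_sum)
  show "class_functions (S \<times> T) (map_prod r s) \<subseteq> fs.span ?P"
    unfolding span_class_sums[OF finite_cartesian_product[OF S T], symmetric]
  proof (rule fs.span_mono, rule subsetI)
    fix t :: "'i \<times> 'j \<Rightarrow>\<^sub>0 'k"
    assume "t \<in> class_sum (S \<times> T) (map_prod r s) ` map_prod r s ` (S \<times> T)"
    then obtain i j where "t = tensor (class_sum S r (r i)) (class_sum T s (s j))"
      by (auto simp: *)
    then show "t \<in> ?P" using S T by (blast intro: class_sum_in_class_functions)
  qed
qed

section \<open>Polynomials in several points that vanish on enough tuples\<close>

section \<open>Interpolation\<close>

text \<open>The value of a monomial in several points. A point of the plane is dehomogenised to one
  coordinate \<open>x\<close>, so only the exponent of X is recorded. In the interpolation argument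
  the points lie in \<open>'k poly\<close>.\<close>

definition ev :: "'a::comm_monoid_mult list \<Rightarrow> nat list \<Rightarrow> 'a"
  where "ev xs es = prod_list (map2 (\<lambda>x e. x ^ e) xs es)"

lemma ev_Nil [simp]: "ev [] es = 1"
  and ev_Cons [simp]: "ev (x # xs) (e # es) = x ^ e * ev xs es"
  by (simp_all add: ev_def)

lemma ev_append:
  "length xs = length es \<Longrightarrow> ev (xs @ ys) (es @ fs) = ev xs es * ev ys fs"
  by (simp add: ev_def)

lemma ev_add:
  fixes xs :: "'a::comm_semiring_1 list"
  shows "length es = length xs \<Longrightarrow> length fs = length xs \<Longrightarrow> ev xs (map2 (+) es fs) = ev xs es * ev xs fs"
proof (induction xs arbitrary: es fs)
  case (Cons x xs)
  then show ?case by (cases es; cases fs) (auto simp: power_add mult_ac)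
qed simp

lemma ev_permute:
  assumes "\<sigma> permutes {..<length es}" "length xs = length es"
  shows "ev (permute_list \<sigma> xs) (permute_list \<sigma> es) = ev xs es"
proof -
  have "mset (zip (permute_list \<sigma> xs) (permute_list \<sigma> es)) = mset (zip xs es)"
    using assms by (simp flip: permute_list_zip)
  then have "mset (map2 (\<lambda>x e. x ^ e) (permute_list \<sigma> xs) (permute_list \<sigma> es)) =
      mset (map2 (\<lambda>x e. x ^ e) xs es)" by simp
  then show ?thesis unfolding ev_def prod_mset_prod_list[symmetric] by (simp only:)
qed

text \<open>A polynomial of degree at most \<open>e\<close> with more than \<open>e\<close> roots in
  a domain is zero. The exponents \<open>f i\<close> may repeat.\<close>

lemma sum_powers_eq_0:
  fixes c :: "'i \<Rightarrow> 'a::idom"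
  assumes S: "finite S" and deg: "\<And>i. i \<in> S \<Longrightarrow> f i \<le> e"
    and A: "finite A" "e < card A" and vanish: "\<And>x. x \<in> A \<Longrightarrow> (\<Sum>i\<in>S. c i * x ^ f i) = 0"
  shows "(\<Sum>i\<in>S. c i * x ^ f i) = 0"
proof -
  define p where "p = (\<Sum>i\<in>S. monom (c i) (f i))"
  have p: "poly p x = (\<Sum>i\<in>S. c i * x ^ f i)" for x
    by (simp add: p_def poly_sum poly_monom)
  have "p = 0"
  proof (rule ccontr)
    assume "p \<noteq> 0"
    have "degree p \<le> e"
      unfolding p_def using S deg by (intro degree_sum_le) (auto intro: order_trans[OF degree_monom_le])
    moreover have "card A \<le> card {x. poly p x = 0}"
      by (rule card_mono) (use poly_roots_finite[OF \<open>p \<noteq> 0\<close>] vanish p in auto)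
    ultimately show False
      using card_poly_roots_bound[OF \<open>p \<noteq> 0\<close>] A by linarith
  qed
  with p[of x] show ?thesis by simp
qed

text \<open>Interpolation in one point at a time. Vanishing is known only on tuples of distinct
  members of \<open>A\<close>, which is why \<open>A\<close> needs \<open>n + e\<close> elements and
  not merely \<open>e + 1\<close>.\<close>

lemma sum_monomials_eq_0:
  fixes c :: "'i \<Rightarrow> 'a::idom"
  assumes S: "finite S" and A: "finite A" "n + e \<le> card A"
    and \<alpha>: "\<And>i. i \<in> S \<Longrightarrow> length (\<alpha> i) = n \<and> set (\<alpha> i) \<subseteq> {..e}"
    and vanish: "\<And>zs. length zs = n \<Longrightarrow> distinct zs \<Longrightarrow> set zs \<subseteq> A \<Longrightarrow>
      (\<Sum>i\<in>S. c i * ev zs (\<alpha> i)) = 0"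
    and xs: "length xs = n"
  shows "(\<Sum>i\<in>S. c i * ev xs (\<alpha> i)) = 0"
  using A(2) \<alpha> vanish xs
proof (induction n arbitrary: c \<alpha> xs)
  case 0
  then show ?case by simp
next
  case (Suc n)
  from Suc.prems(4) obtain x ys where xs: "xs = x # ys" "length ys = n" by (cases xs) auto
  have \<alpha>: "\<alpha> i = hd (\<alpha> i) # tl (\<alpha> i)" "hd (\<alpha> i) \<le> e" "length (tl (\<alpha> i)) = n" "set (tl (\<alpha> i)) \<subseteq> {..e}"
    if "i \<in> S" for i
    using Suc.prems(2)[OF that] by (cases "\<alpha> i"; auto)+
  have split: "(\<Sum>i\<in>S. c i * ev (x # zs) (\<alpha> i)) = (\<Sum>i\<in>S. (c i * ev zs (tl (\<alpha> i))) * x ^ hd (\<alpha> i))"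
    for x zs
    by (rule sum.cong[OF refl], subst \<alpha>(1)) (simp_all add: mult_ac)
  \<comment> \<open>Once the other \<open>n\<close> points are fixed in \<open>A\<close>, at least
    \<open>e + 1\<close> members of \<open>A\<close> remain for the first point, enough to free it
    completely.\<close>
  have *: "(\<Sum>i\<in>S. c i * ev (x # zs) (\<alpha> i)) = 0"
    if zs: "length zs = n" "distinct zs" "set zs \<subseteq> A" for zs
    unfolding split
  proof (rule sum_powers_eq_0[OF S \<alpha>(2)])
    show "finite (A - set zs)" using A by simp
    show "e < card (A - set zs)"
      using Suc.prems(1) zs card_Diff_subset[of "set zs" A] by (simp add: distinct_card)
    fix y assume "y \<in> A - set zs"
    with zs show "(\<Sum>i\<in>S. (c i * ev zs (tl (\<alpha> i))) * y ^ hd (\<alpha> i)) = 0"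
      unfolding split[symmetric] by (intro Suc.prems(3)) auto
  qed
  have split': "(\<Sum>i\<in>S. c i * ev (x # zs) (\<alpha> i)) = (\<Sum>i\<in>S. (c i * x ^ hd (\<alpha> i)) * ev zs (tl (\<alpha> i)))"
    for zs
    unfolding split by (simp add: mult_ac)
  \<comment> \<open>With the first point arbitrary but fixed, its powers are absorbed into the
    coefficients and the induction hypothesis frees the others.\<close>
  show ?case
    unfolding xs(1) split'
    by (rule Suc.IH) (use Suc.prems(1) \<alpha> xs *[unfolded split'] in auto)
qed

text \<open>Base \<open>N\<close> with the least significant digit first: the exponent to which
  Kronecker substitution sends a monomial with exponent list \<open>l\<close>.\<close>

fun digits_value :: "nat \<Rightarrow> nat list \<Rightarrow> nat"
  where "digits_value N [] = 0"
  | "digits_value N (a # l) = a + N * digits_value N l"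

lemma digits_value_inj:
  assumes "length l = length m" "set l \<subseteq> {..<N}" "set m \<subseteq> {..<N}"
    "digits_value N l = digits_value N m"
  shows "l = m"
  using assms
proof (induction l m rule: list_induct2)
  case (Cons a l b m)
  then have lt: "a < N" "b < N" and eq: "a + N * digits_value N l = b + N * digits_value N m" by auto
  from arg_cong[OF eq, of "\<lambda>x. x mod N"] lt have "a = b" by simp
  with eq lt have "digits_value N l = digits_value N m" by simp
  with Cons \<open>a = b\<close> show ?case by simp
qed simp

text \<open>Kronecker substitution: the \<open>r\<close>-th variable becomes \<open>X\<^bsup>N\<^sup>r\<^esup>\<close>.\<close>

definition kronecker_point :: "nat \<Rightarrow> nat \<Rightarrow> 'k::field poly"
  where "kronecker_point N r = monom 1 (N ^ r)"

lemma ev_kronecker_point: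
  "ev (map (kronecker_point N) [0..<length l]) l = (monom 1 (digits_value N l) :: 'k::field poly)"
proof -
  \<comment> \<open>The factor \<open>M\<close> generalises the claim for the induction: the points
    of the tail start at the power \<open>N\<close> instead of 1.\<close>
  have "ev (map (\<lambda>r. monom 1 (M * N ^ r)) [0..<length l]) l = (monom 1 (M * digits_value N l) :: 'k poly)" for M
  proof (induction l arbitrary: M)
    case (Cons a l)
    have "map (\<lambda>r. monom 1 (M * N ^ r)) [0..<length (a # l)] =
        monom 1 M # map (\<lambda>r. monom (1::'k) (M * N * N ^ r)) [0..<length l]"
      by (simp add: upt_conv_Cons map_Suc_upt[symmetric] mult_ac del: upt_Suc)
    with Cons[of "M * N"] show ?case
      by (simp add: monom_power mult_monom algebra_simps del: upt_Suc)
  qed (simp add: one_poly_eq_simps)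
  from this[of 1] show ?thesis by (simp add: kronecker_point_def[abs_def])
qed

text \<open>Distinct exponent lists with digits below \<open>N\<close> give distinct powers of one
  indeterminate, so each \<open>v i\<close> is a coefficient of the resulting polynomial. Passing to
  \<open>'k poly\<close> supplies enough points even when the field is finite.\<close>

lemma kronecker_point_separates:
  fixes v :: "'i \<Rightarrow> 'k::field"
  assumes S: "finite S" and \<gamma>: "\<And>i. i \<in> S \<Longrightarrow> length (\<gamma> i) = n \<and> set (\<gamma> i) \<subseteq> {..<N}"
    and inj: "inj_on \<gamma> S"
    and 0: "(\<Sum>i\<in>S. [:v i:] * ev (map (kronecker_point N) [0..<n]) (\<gamma> i)) = 0"
    and i: "i \<in> S"
  shows "v i = 0"
proof -
  have "(\<Sum>j\<in>S. [:v j:] * ev (map (kronecker_point N) [0..<n]) (\<gamma> j)) =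
      (\<Sum>j\<in>S. monom (v j) (digits_value N (\<gamma> j)))"
  proof (rule sum.cong[OF refl])
    fix j assume "j \<in> S"
    with ev_kronecker_point[of N "\<gamma> j", where 'k = 'k] \<gamma>
    show "[:v j:] * ev (map (kronecker_point N) [0..<n]) (\<gamma> j) = monom (v j) (digits_value N (\<gamma> j))"
      by (simp add: smult_monom)
  qed
  with 0 have "0 = coeff (\<Sum>j\<in>S. monom (v j) (digits_value N (\<gamma> j))) (digits_value N (\<gamma> i))" by simp
  also have "\<dots> = (\<Sum>j\<in>S. if j = i then v j else 0)"
    unfolding coeff_sum coeff_monom
  proof (rule sum.cong[OF refl])
    fix j assume "j \<in> S"
    then show "(if digits_value N (\<gamma> j) = digits_value N (\<gamma> i) then v j else 0) = (if j = i then v j else 0)"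
      using digits_value_inj[of "\<gamma> j" "\<gamma> i" N] \<gamma> i inj_onD[OF inj, of j i] by auto
  qed
  also have "\<dots> = v i" using S i by simp
  finally show ?thesis by simp
qed

lemma distinct_kronecker_points:
  "1 < N \<Longrightarrow> distinct (map (kronecker_point N :: nat \<Rightarrow> 'k::field poly) [0..<n])"
  by (auto simp: distinct_map inj_on_def kronecker_point_def monom_eq_iff')

text \<open>
  In dehomogenised form, \<open>F xs ps\<close> is the value of the polynomial with coefficients \<open>v\<close>: it has degree
  at most \<open>e\<close> in each of the \<open>n\<close> points \<open>xs\<close> and is symmetric in the \<open>n + e\<close> points \<open>ps\<close>.
\<close>

lemma specialisation_injective:
  fixes v :: "'i \<Rightarrow> 'k::field" and \<alpha> \<beta> :: "'i \<Rightarrow> nat list" and S :: "'i set"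
  defines "F \<equiv> \<lambda>xs ps. \<Sum>i\<in>S. [:v i:] * (ev xs (\<alpha> i) * ev ps (\<beta> i))"
  assumes S: "finite S"
    and \<alpha>: "\<And>i. i \<in> S \<Longrightarrow> length (\<alpha> i) = n \<and> set (\<alpha> i) \<subseteq> {..e}"
    and \<beta>: "\<And>i. i \<in> S \<Longrightarrow> length (\<beta> i) = n + e"
    and inj: "inj_on (\<lambda>i. \<alpha> i @ \<beta> i) S"
    and sym: "\<And>xs ps qs. length ps = n + e \<Longrightarrow> mset ps = mset qs \<Longrightarrow> F xs ps = F xs qs"
    and diagonal: "\<And>xs ys. length xs = n \<Longrightarrow> length ys = e \<Longrightarrow> F xs (ys @ xs) = 0"
    and i: "i \<in> S"
  shows "v i = 0"
proof -
  \<comment> \<open>\<open>N\<close> exceeds every exponent, so that exponents are base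
    \<open>N\<close> digits. Including 1 in the set forces \<open>N > 1\<close>, without which the
    Kronecker points would coincide.\<close>
  obtain N where N: "1 < N" "\<And>i. i \<in> S \<Longrightarrow> set (\<alpha> i @ \<beta> i) \<subseteq> {..<N}"
  proof
    let ?X = "insert 1 (\<Union>i\<in>S. set (\<alpha> i @ \<beta> i))"
    have "finite ?X" using S by simp
    then have x: "x < Suc (Max ?X)" if "x \<in> ?X" for x
      using that by (simp only: less_Suc_eq_le Max_ge)
    show "1 < Suc (Max ?X)" using x by blast
    show "set (\<alpha> i @ \<beta> i) \<subseteq> {..<Suc (Max ?X)}" if "i \<in> S" for i
      using x that by blast
  qed
  define pts where "pts = map (kronecker_point N :: nat \<Rightarrow> 'k poly) [0..<n + (n + e)]"
  define xs where "xs = take n pts"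
  define ps where "ps = drop n pts"
  have pts: "distinct pts" "length pts = n + (n + e)"
    using N(1) by (simp_all add: pts_def distinct_kronecker_points)
  have len: "length xs = n" "length ps = n + e" and dist: "distinct ps" and app: "pts = xs @ ps"
    using pts by (simp_all add: xs_def ps_def)
  \<comment> \<open>Here \<open>ps\<close> stays fixed and the polynomial is interpolated in
    \<open>xs\<close>, with the members of \<open>ps\<close> as the nodes.\<close>
  have "(\<Sum>i\<in>S. ([:v i:] * ev ps (\<beta> i)) * ev xs (\<alpha> i)) = 0"
  proof (rule sum_monomials_eq_0[OF S, of "set ps" n e])
    show "finite (set ps)" "n + e \<le> card (set ps)"
      using dist len by (simp_all add: distinct_card)
    fix zs assume zs: "length zs = n" "distinct zs" "set zs \<subseteq> set ps"
    \<comment> \<open>By symmetry the points \<open>zs\<close> may be moved to the end of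
      \<open>ps\<close>. The remaining \<open>e\<close> points are \<open>ys\<close>, and the
      vanishing on the diagonal applies.\<close>
    define ys where "ys = filter (\<lambda>p. p \<notin> set zs) ps"
    have "mset (filter (\<lambda>p. p \<in> set zs) ps) = mset zs"
      using zs dist by (subst set_eq_iff_mset_eq_distinct[symmetric]) auto
    then have m: "mset ps = mset (ys @ zs)"
      unfolding ys_def using multiset_partition[of "mset ps" "\<lambda>p. p \<in> set zs"] by (simp add: add.commute)
    from mset_eq_length[OF this] have "length ys = e" using len zs by simp
    with sym[OF len(2) m, of zs] diagonal[of zs ys] zs have "F zs ps = 0" by simp
    then show "(\<Sum>i\<in>S. ([:v i:] * ev ps (\<beta> i)) * ev zs (\<alpha> i)) = 0"
      unfolding F_def by (simp add: mult_ac)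
  qed (use \<alpha> len in auto)
  moreover have "ev pts (\<alpha> i @ \<beta> i) = ev xs (\<alpha> i) * ev ps (\<beta> i)" if "i \<in> S" for i
    unfolding app using \<alpha>[OF that] len by (simp add: ev_append)
  ultimately have "(\<Sum>i\<in>S. [:v i:] * ev (map (kronecker_point N) [0..<n + (n + e)]) (\<alpha> i @ \<beta> i)) = 0"
    by (simp add: pts_def[symmetric] mult_ac)
  then show ?thesis
    by (rule kronecker_point_separates[OF S _ inj _ i, rotated]) (use \<alpha> \<beta> N in auto)
qed

section \<open>Linear maps given by maps of basis indices, and a criterion for isomorphism\<close>

section \<open>Push-forward along maps of basis elements\<close>

text \<open>Setting points equal turns a product of monomials into a monomial, so each of the three
  specialisations has this form.\<close>

definition push :: "('i \<Rightarrow> 'j) \<Rightarrow> ('i \<Rightarrow>\<^sub>0 'k::field) \<Rightarrow> ('j \<Rightarrow>\<^sub>0 'k)"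
  where "push f = lin_ext (\<lambda>i. single (f i) 1)"

lemma push_single [simp]: "push f (single i 1) = single (f i) 1"
  by (simp add: push_def)

lemma linear_push: "Vector_Spaces.linear scl scl (push f)"
  unfolding push_def by (rule linear_lin_ext)

lemma lookup_push:
  assumes "finite S" "keys v \<subseteq> S"
  shows "lookup (push f v) j = (\<Sum>i\<in>{i\<in>S. f i = j}. lookup v i)"
proof -
  have "lookup (push f v) j = (\<Sum>i\<in>S. if f i = j then lookup v i else 0)"
    unfolding push_def lin_ext_superset[OF assms] lookup_sum
    by (rule sum.cong) (auto simp: lookup_single)
  then show ?thesis using assms(1) by (simp add: sum.inter_filter)
qed

lemma in_span_singles: "(\<And>i. i \<in> keys v \<Longrightarrow> single i 1 \<in> fs.span B) \<Longrightarrow> v \<in> fs.span B"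
proof -
  assume B: "\<And>i. i \<in> keys v \<Longrightarrow> single i 1 \<in> fs.span B"
  have "v = (\<Sum>i\<in>keys v. scl (lookup v i) (single i 1))"
    by (simp flip: lin_ext_def)
  also have "\<dots> \<in> fs.span B"
    by (intro fs.span_sum fs.span_scale B)
  finally show ?thesis .
qed

text \<open>A coefficient of the image is a sum over a fibre. The maps \<open>\<pi>\<close>,
  available for both orders of \<open>j\<close> and \<open>j'\<close>, show that the two fibres have
  equal size. Hence each is a bijection, and it preserves classes, so the two sums agree.\<close>

lemma push_in_class_functions:
  assumes S: "finite S" and v: "v \<in> class_functions S r" and f: "\<And>i. i \<in> S \<Longrightarrow> f i \<in> T"
    and fibres: "\<And>j j'. j \<in> T \<Longrightarrow> j' \<in> T \<Longrightarrow> s j = s j' \<Longrightarrow>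
      \<exists>\<pi>. inj_on \<pi> {i\<in>S. f i = j} \<and> (\<forall>i\<in>S. f i = j \<longrightarrow> \<pi> i \<in> S \<and> f (\<pi> i) = j' \<and> r (\<pi> i) = r i)"
  shows "push f v \<in> class_functions T s"
proof -
  have keys: "keys v \<subseteq> S" using v by (simp add: class_functions_def)
  let ?F = "\<lambda>j. {i\<in>S. f i = j}"
  have fin: "finite (?F j)" for j using S by simp
  have card: "card (?F j) \<le> card (?F j')" if jj: "j \<in> T" "j' \<in> T" "s j = s j'" for j j'
  proof -
    obtain \<pi> where "inj_on \<pi> (?F j)" "\<forall>i\<in>S. f i = j \<longrightarrow> \<pi> i \<in> S \<and> f (\<pi> i) = j' \<and> r (\<pi> i) = r i"
      using fibres[OF jj] by blast
    then show ?thesis by (intro card_inj_on_le[OF _ _ fin]) auto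
  qed
  show ?thesis
  proof (rule class_functionsI)
    fix j assume "j \<notin> T"
    then have "?F j = {}" using f by auto
    then show "lookup (push f v) j = 0" unfolding lookup_push[OF S keys] by (simp only: sum.empty)
  next
    fix j j' assume jj: "j \<in> T" "j' \<in> T" "s j = s j'"
    obtain \<pi> where \<pi>: "inj_on \<pi> (?F j)" "\<forall>i\<in>S. f i = j \<longrightarrow> \<pi> i \<in> S \<and> f (\<pi> i) = j' \<and> r (\<pi> i) = r i"
      using fibres[OF jj] by blast
    have "\<pi> ` ?F j = ?F j'"
    proof (rule card_seteq[OF fin])
      show "\<pi> ` ?F j \<subseteq> ?F j'" using \<pi>(2) by auto
      show "card (?F j') \<le> card (\<pi> ` ?F j)"
        using card[OF jj(2,1)] jj(3) \<pi>(1) by (simp add: card_image)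
    qed
    then have "lookup (push f v) j' = (\<Sum>i\<in>\<pi> ` ?F j. lookup v i)"
      by (simp add: lookup_push[OF S keys])
    also have "\<dots> = (\<Sum>i\<in>?F j. lookup v i)"
      unfolding sum.reindex[OF \<pi>(1)] comp_def
    proof (rule sum.cong[OF refl])
      fix i assume "i \<in> ?F j"
      with \<pi>(2) show "lookup v (\<pi> i) = lookup v i" by (intro class_functionsD(2)[OF v]) auto
    qed
    finally show "lookup (push f v) j = lookup (push f v) j'"
      by (simp add: lookup_push[OF S keys])
  qed
qed

text \<open>Needed for (i), where specialisation produces the inverse of the stated
  isomorphism.\<close>

lemma rep_iso_sym: "V \<cong>\<^sub>S\<^sub>L W \<Longrightarrow> W \<cong>\<^sub>S\<^sub>L V"
proof -
  assume "V \<cong>\<^sub>S\<^sub>L W"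
  then obtain \<phi> where V: "is_rep V" and W: "is_rep W" and bij: "bij_betw \<phi> (space V) (space W)"
    and add: "\<And>u v. u \<in> space V \<Longrightarrow> v \<in> space V \<Longrightarrow> \<phi> (u + v) = \<phi> u + \<phi> v"
    and scale: "\<And>c v. v \<in> space V \<Longrightarrow> \<phi> (scl c v) = scl c (\<phi> v)"
    and act: "\<And>g v. g \<in> SL2 \<Longrightarrow> v \<in> space V \<Longrightarrow> \<phi> (act V g v) = act W g (\<phi> v)"
    unfolding rep_iso_def by blast
  note sub = is_repD(1)[OF V]
  define \<psi> where "\<psi> = inv_into (space V) \<phi>"
  have \<psi>: "\<psi> w \<in> space V" "\<phi> (\<psi> w) = w" if "w \<in> space W" for w
    using that bij bij_betw_imp_surj_on[OF bij] unfolding \<psi>_def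
    by (auto intro: inv_into_into f_inv_into_f)
  have \<psi>_eq: "\<psi> w = v" if "v \<in> space V" "\<phi> v = w" for v w
    using that bij by (auto simp: \<psi>_def bij_betw_def)
  show ?thesis
    unfolding rep_iso_def
  proof (intro conjI exI[of _ \<psi>] ballI allI W V)
    show "bij_betw \<psi> (space W) (space V)"
      unfolding \<psi>_def using bij by (rule bij_betw_inv_into)
  qed (use \<psi> sub is_repD(3)[OF V] in
      \<open>auto intro!: \<psi>_eq simp: add scale act fs.subspace_add fs.subspace_scale\<close>)
qed

text \<open>Surjectivity comes from injectivity and equality of dimensions, so no inverse has to be
  written down.\<close>

lemma rep_iso_push:
  fixes V :: "('k::field, 'i) sl2_rep" and W :: "('k, 'j) sl2_rep"
  assumes V: "is_rep V" and W: "is_rep W"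
    and S: "finite S" and T: "finite T"
    and space_V: "space V = class_functions S r" and space_W: "space W = class_functions T s"
    and card: "card (r ` S) = card (s ` T)"
    and f: "\<And>i. i \<in> S \<Longrightarrow> f i \<in> T"
    and fibres: "\<And>j j'. j \<in> T \<Longrightarrow> j' \<in> T \<Longrightarrow> s j = s j' \<Longrightarrow>
      \<exists>\<pi>. inj_on \<pi> {i\<in>S. f i = j} \<and> (\<forall>i\<in>S. f i = j \<longrightarrow> \<pi> i \<in> S \<and> f (\<pi> i) = j' \<and> r (\<pi> i) = r i)"
    and inj: "\<And>v :: 'i \<Rightarrow>\<^sub>0 'k. v \<in> class_functions S r \<Longrightarrow> push f v = 0 \<Longrightarrow> v = 0"
    and equivariant: "\<And>g i. g \<in> SL2 \<Longrightarrow> i \<in> S \<Longrightarrow>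
      push f (act V g (single i 1)) = act W g (single (f i) 1)"
  shows "V \<cong>\<^sub>S\<^sub>L W"
proof -
  interpret p: Vector_Spaces.linear scl scl "push f :: ('i \<Rightarrow>\<^sub>0 'k) \<Rightarrow> _" by (rule linear_push)
  have im: "push f ` space V \<subseteq> space W"
    unfolding space_V space_W using push_in_class_functions[OF S _ f fibres] by blast
  have inj': "inj_on (push f) (space V)"
    using is_repD(1)[OF V] inj
    by (subst p.inj_on_iff_eq_0) (simp_all add: space_V)
  have "push f ` space V = space W"
    using linear_inj_on_class_functions_surj[OF S T card linear_push im[unfolded space_V space_W]] inj'
    by (simp add: space_V space_W)
  with inj' have bij: "bij_betw (push f) (space V) (space W)" by (simp add: bij_betw_def)
  \<comment> \<open>Single basis elements need not lie in \<open>space V\<close>. The comparison on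
    them is still meaningful because the action is linear on the whole ambient space.\<close>
  have "push f (act V g v) = act W g (push f v)" if g: "g \<in> SL2" and v: "v \<in> space V" for g v
  proof (rule linear_eq_on_span[where S = "(\<lambda>i. single i 1) ` S"])
    show "Vector_Spaces.linear scl scl (\<lambda>v. push f (act V g v))"
      "Vector_Spaces.linear scl scl (\<lambda>v. act W g (push f v))"
      by (rule linear_comp[OF linear_push is_repD(2)[OF V g]]
          linear_comp[OF is_repD(2)[OF W g] linear_push])+
    show "v \<in> fs.span ((\<lambda>i. single i 1) ` S)"
      by (rule in_span_singles, rule fs.span_base) (use v in \<open>auto simp: space_V class_functions_def\<close>)
  qed (use equivariant[OF g] in auto)
  with bij show ?thesis
    unfolding rep_iso_def using V W by (auto simp: p.add p.scale)
qed

section \<open>Monomial descriptions and dimensions of the symmetric powers\<close>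

section \<open>The spaces of the representations\<close>

lemma class_functions_id: "class_functions S id = {v. keys v \<subseteq> S}"
  by (auto simp: class_functions_def)

abbreviation monomials :: "nat \<Rightarrow> (nat \<times> nat) set"
  where "monomials d \<equiv> {(i, j). i + j = d}"

abbreviation words :: "'i set \<Rightarrow> nat \<Rightarrow> 'i list set"
  where "words D R \<equiv> {l. set l \<subseteq> D \<and> length l = R}"

lemma monomials_eq: "monomials d = (\<lambda>i. (i, d - i)) ` {..d}"
  by force

lemma finite_monomials: "finite (monomials d)"
  unfolding monomials_eq by simp

lemma card_monomials: "card (monomials d) = Suc d"
  unfolding monomials_eq by (simp add: card_image inj_on_def)

lemma space_natural_rep: "space natural_rep = class_functions UNIV id"
  by (simp add: class_functions_id natural_rep_def)

lemma space_Sym_up: "space (Sym_up d) = class_functions (monomials d) id"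
  by (auto simp: class_functions_id Sym_up_def)

lemma space_rep_tensor_power:
  fixes V :: "('k::field, 'i) sl2_rep"
  assumes V: "space V = class_functions D id"
  shows "space (rep_tensor_power R V) = class_functions (words D R) id"
proof -
  let ?P = "{tensor_list vs | vs. length vs = R \<and> set vs \<subseteq> space V}"
  have "fs.span ?P \<subseteq> class_functions (words D R) id"
  proof (rule fs.span_minimal[OF _ subspace_class_functions], safe)
    fix vs :: "('i \<Rightarrow>\<^sub>0 'k) list" assume vs: "set vs \<subseteq> space V" "R = length vs"
    have "l \<in> words D R" if l: "l \<in> keys (tensor_list vs)" for l
    proof -
      from l have nz: "lookup (vs ! r) (l ! r) \<noteq> 0" if "r < length vs" for r
        using that by (auto simp: in_keys_iff lookup_tensor_list split: if_splits)
      have len: "length l = length vs"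
        using l by (auto simp: in_keys_iff lookup_tensor_list split: if_splits)
      have "l ! r \<in> D" if "r < length vs" for r
      proof -
        have "vs ! r \<in> class_functions D id" using vs that V by auto
        then show ?thesis using nz[OF that] class_functionsD(1)[of "vs ! r" D id "l ! r"] by blast
      qed
      with len vs show ?thesis by (auto simp: in_set_conv_nth)
    qed
    then show "tensor_list vs \<in> class_functions (words D (length vs)) id"
      using vs by (auto simp: class_functions_id)
  qed
  moreover have "class_functions (words D R) id \<subseteq> fs.span ?P"
  proof
    fix w :: "'i list \<Rightarrow>\<^sub>0 'k" assume w: "w \<in> class_functions (words D R) id"
    show "w \<in> fs.span ?P"
    proof (rule in_span_singles, rule fs.span_base)
      fix l assume "l \<in> keys w"
      then have l: "set l \<subseteq> D" "length l = R" using w by (auto simp: class_functions_id)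
      then have "set (map (\<lambda>i. single i (1::'k)) l) \<subseteq> space V"
        using V by (auto simp: class_functions_id)
      with l(2) show "single l 1 \<in> ?P"
        by (intro CollectI exI[of _ "map (\<lambda>i. single i 1) l"]) simp
    qed
  qed
  ultimately show ?thesis by (simp add: rep_tensor_power_def)
qed

lemma permute_list_inverse:
  assumes "\<sigma> permutes {..<length l}"
  shows "permute_list (inv \<sigma>) (permute_list \<sigma> l) = l"
    "permute_list \<sigma> (permute_list (inv \<sigma>) l) = l"
  using assms permute_list_compose[of \<sigma> l "inv \<sigma>"] permute_list_compose[of "inv \<sigma>" l \<sigma>]
  by (auto simp: permutes_inv permutes_inv_o)

lemma lookup_permute_tensor:
  assumes \<sigma>: "\<sigma> permutes {..<length m}" and w: "\<And>l. l \<in> keys w \<Longrightarrow> length l = length m"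
  shows "lookup (permute_tensor \<sigma> w) m = lookup w (permute_list \<sigma> m)"
proof -
  have "permute_list (inv \<sigma>) l = m \<longleftrightarrow> l = permute_list \<sigma> m" if "l \<in> keys w" for l
    by (metis permute_list_inverse \<sigma> w[OF that])
  then have "{l \<in> keys w. permute_list (inv \<sigma>) l = m} = {l \<in> keys w. l = permute_list \<sigma> m}"
    by blast
  then have "lookup (permute_tensor \<sigma> w) m = (\<Sum>l\<in>{l \<in> keys w. l = permute_list \<sigma> m}. lookup w l)"
    using lookup_push[of "keys w" w "permute_list (inv \<sigma>)" m]
    by (simp add: push_def permute_tensor_def)
  also have "\<dots> = (\<Sum>l\<in>keys w. if l = permute_list \<sigma> m then lookup w l else 0)"
    by (simp only: sum.inter_filter[OF finite_keys])
  also have "\<dots> = lookup w (permute_list \<sigma> m)"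
    by (simp add: in_keys_iff)
  finally show ?thesis .
qed

text \<open>Words of equal length differ by a permutation of positions exactly when their multisets
  of letters agree, so invariance means constancy of the coefficients on these classes.\<close>

lemma space_Sym_low:
  fixes V :: "('k::field, 'i) sl2_rep"
  assumes V: "space V = class_functions D id"
  shows "space (Sym_low R V) = class_functions (words D R) mset"
proof (rule set_eqI, rule iffI)
  fix w :: "'i list \<Rightarrow>\<^sub>0 'k"
  assume "w \<in> space (Sym_low R V)"
  then have w: "keys w \<subseteq> words D R" and inv: "\<And>\<sigma>. \<sigma> permutes {..<R} \<Longrightarrow> permute_tensor \<sigma> w = w"
    by (simp_all add: Sym_low_def space_rep_tensor_power[OF V] class_functions_id)
  show "w \<in> class_functions (words D R) mset"
  proof (rule class_functionsI)
    fix l m assume lm: "l \<in> words D R" "m \<in> words D R" "mset l = mset m"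
    from lm(3) obtain \<sigma> where \<sigma>: "\<sigma> permutes {..<length m}" "permute_list \<sigma> m = l"
      by (rule mset_eq_permutation)
    have "lookup (permute_tensor \<sigma> w) m = lookup w l"
      using lookup_permute_tensor[OF \<sigma>(1), of w] w lm \<sigma> by auto
    then show "lookup w l = lookup w m" using inv[of \<sigma>] \<sigma>(1) lm(2) by simp
  qed (use w in \<open>auto simp: in_keys_iff\<close>)
next
  fix w :: "'i list \<Rightarrow>\<^sub>0 'k"
  assume w: "w \<in> class_functions (words D R) mset"
  then have keys: "keys w \<subseteq> words D R" by (simp add: class_functions_def)
  have "permute_tensor \<sigma> w = w" if \<sigma>: "\<sigma> permutes {..<R}" for \<sigma>
  proof (rule poly_mapping_eqI)
    fix m
    show "lookup (permute_tensor \<sigma> w) m = lookup w m"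
    proof (cases "length m = R")
      case True
      then have "lookup (permute_tensor \<sigma> w) m = lookup w (permute_list \<sigma> m)"
        using \<sigma> keys by (intro lookup_permute_tensor) auto
      also have "\<dots> = lookup w m"
      proof (cases "m \<in> words D R")
        case True
        then show ?thesis using \<sigma> by (intro class_functionsD(2)[OF w]) auto
      next
        case False
        then have "permute_list \<sigma> m \<notin> words D R" using \<sigma> \<open>length m = R\<close> by auto
        with False show ?thesis using class_functionsD(1)[OF w] by presburger
      qed
      finally show ?thesis .
    next
      case False
      \<comment> \<open>Permuting positions preserves length, so a word of another length has
        coefficient zero on both sides.\<close>
      then have empty: "{l \<in> keys w. permute_list (inv \<sigma>) l = m} = {}" and m: "m \<notin> keys w"
        using keys by auto
      have "lookup (push (permute_list (inv \<sigma>)) w) m = 0"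
        by (subst lookup_push[OF finite_keys order_refl]) (simp only: empty sum.empty)
      then show ?thesis
        using m by (simp add: push_def permute_tensor_def in_keys_iff)
    qed
  qed
  then show "w \<in> space (Sym_low R V)"
    using keys by (simp add: Sym_low_def space_rep_tensor_power[OF V] class_functions_id)
qed

lemma space_rep_tensor:
  assumes "finite S" "finite T" "space V = class_functions S r" "space W = class_functions T s"
  shows "space (V \<otimes>\<^sub>S\<^sub>L W) = class_functions (S \<times> T) (map_prod r s)"
  using assms by (simp add: rep_tensor_def span_tensor_class_functions)

lemma finite_words: "finite D \<Longrightarrow> finite (words D R)"
  by (rule finite_lists_length_eq)

lemma card_map_prod_image:
  "finite A \<Longrightarrow> finite B \<Longrightarrow> card (map_prod f g ` (A \<times> B)) = card (f ` A) * card (g ` B)"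
  by (simp add: map_prod_surj_on[OF refl refl] card_cartesian_product)

text \<open>Stars and bars. The \<open>d + 1\<close> monomials of degree \<open>d\<close> give
  \<open>d + R choose R\<close> classes, and the two letters of E give \<open>R + 1\<close>.\<close>

lemma card_mset_words:
  assumes "finite D"
  shows "card (mset ` words D R) = (card D + R - 1) choose R"
proof -
  have "mset ` words D R = multisets_of_size D R"
  proof (rule antisym; rule subsetI)
    fix X assume X: "X \<in> multisets_of_size D R"
    obtain l where "mset l = X" using ex_mset by blast
    with X show "X \<in> mset ` words D R" by (auto simp: multisets_of_size_def)
  qed (auto simp: multisets_of_size_def)
  then show ?thesis by (simp add: card_multisets_of_size assms)
qed

section \<open>Specialisation of points on pure tensors, compared with the group action\<close>

section \<open>Equivariance\<close>

lemma linear_scl_ident: "Vector_Spaces.linear scl scl (\<lambda>v. v)"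
  by (rule linearI) simp_all

lemmas linear_intros = linear_scl_ident linear_push linear_tensor_right linear_cons_tensor_right linear_mult_left
  linear_comp[OF linear_push]
  linear_comp[OF linear_tensor_left] linear_comp[OF linear_tensor_right]
  linear_comp[OF linear_cons_tensor_left] linear_comp[OF linear_cons_tensor_right]
  linear_comp[OF linear_mult_left] linear_comp[OF linear_mult_right]

text \<open>Multilinear identities are proved by extending one argument at a time. The basis case is
  the first premise so that \<open>OF\<close> can supply it and leave the linearity goals to
  \<open>linear_intros\<close>.\<close>

lemma linear_extI:
  assumes "\<And>i. f (single i 1) = h (single i 1)"
    "Vector_Spaces.linear scl scl f" "Vector_Spaces.linear scl scl h"
  shows "f v = h v"
  using linear_eqI[of f h] assms by simp

text \<open>The specialisation for (i): adding indices multiplies monomials, so setting the point W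
  equal to the first Z multiplies the two polynomials.\<close>

lemma push_multiply_head:
  fixes p q :: "nat \<times> nat \<Rightarrow>\<^sub>0 'k::field"
  shows "push (\<lambda>(w, l). (w + hd l, tl l)) (tensor p (cons_tensor q t)) = tensor (p * q) t"
proof -
  let ?f = "push (\<lambda>(w :: nat \<times> nat, l). (w + hd l, tl l))"
  have 1: "?f (tensor (single a 1) (cons_tensor (single b 1) t)) = tensor (single a 1 * single b 1) t" for a b
    by (rule linear_extI[of "\<lambda>t. ?f (tensor (single a 1) (cons_tensor (single b 1) t))"])
      (simp_all add: mult_single, (intro linear_intros)+)
  have 2: "?f (tensor (single a 1) (cons_tensor q t)) = tensor (single a 1 * q) t" for a
    by (rule linear_extI[of "\<lambda>q. ?f (tensor (single a 1) (cons_tensor q t))", OF 1]; intro linear_intros)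
  show ?thesis
    by (rule linear_extI[of "\<lambda>p. ?f (tensor p (cons_tensor q t))", OF 2]; intro linear_intros)
qed

text \<open>The exponent of X in a basis vector of E: the index 1 stands for X and the other index
  for Y.\<close>

definition exponent :: "2 \<Rightarrow> nat"
  where "exponent i = (if i = 1 then 1 else 0)"

definition variable :: "2 \<Rightarrow> nat \<times> nat"
  where "variable i = (exponent i, 1 - exponent i)"

text \<open>The effect on basis elements of identifying the two points in each position: a linear
  monomial is multiplied into the monomial beside it.\<close>

definition multiply_words :: "2 list \<times> (nat \<times> nat) list \<Rightarrow> (nat \<times> nat) list"
  where "multiply_words = (\<lambda>(us, l). map2 (\<lambda>u z. variable u + z) us l)"

lemma push_multiply_words_cons:
  "push multiply_words (tensor (cons_tensor u s) (cons_tensor p t)) =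
    cons_tensor (push variable u * p) (push multiply_words (tensor s t))"
proof -
  let ?f = "push multiply_words"
  have 1: "?f (tensor (cons_tensor (single a 1) (single l 1)) (cons_tensor (single b 1) t)) =
      cons_tensor (push variable (single a 1) * single b 1) (?f (tensor (single l 1) t))" for a b l
    by (rule linear_extI[of "\<lambda>t. ?f (tensor (cons_tensor (single a 1) (single l 1)) (cons_tensor (single b 1) t))"])
      (simp_all add: mult_single multiply_words_def, (intro linear_intros)+)
  have 2: "?f (tensor (cons_tensor (single a 1) s) (cons_tensor (single b 1) t)) =
      cons_tensor (push variable (single a 1) * single b 1) (?f (tensor s t))" for a b
    by (rule linear_extI[of "\<lambda>s. ?f (tensor (cons_tensor (single a 1) s) (cons_tensor (single b 1) t))", OF 1];
        intro linear_intros)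
  have 3: "?f (tensor (cons_tensor (single a 1) s) (cons_tensor p t)) =
      cons_tensor (push variable (single a 1) * p) (?f (tensor s t))" for a
    by (rule linear_extI[of "\<lambda>p. ?f (tensor (cons_tensor (single a 1) s) (cons_tensor p t))", OF 2];
        intro linear_intros)
  show ?thesis
    by (rule linear_extI[of "\<lambda>u. ?f (tensor (cons_tensor u s) (cons_tensor p t))", OF 3];
        intro linear_intros)
qed

lemma push_multiply_words:
  "length us = length ps \<Longrightarrow> push multiply_words (tensor (tensor_list us) (tensor_list ps)) =
    tensor_list (map2 (\<lambda>u p. push variable u * p) us ps)"
proof (induction us ps rule: list_induct2)
  case Nil
  show ?case by (simp add: multiply_words_def)
qed (simp add: push_multiply_words_cons)

text \<open>The specialisation for (ii): the first point Z is kept as a separate tensor factor and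
  the others are identified with the points W.\<close>

lemma push_multiply_words_tail:
  "push (\<lambda>(us, l). (hd l, multiply_words (us, tl l))) (tensor s (cons_tensor p t)) =
    tensor p (push multiply_words (tensor s t))"
proof -
  let ?f = "push (\<lambda>(us, l). (hd l, multiply_words (us, tl l)))"
  have 1: "?f (tensor (single a 1) (cons_tensor (single b 1) t)) =
      tensor (single b 1) (push multiply_words (tensor (single a 1) t))" for a b
    by (rule linear_extI[of "\<lambda>t. ?f (tensor (single a 1) (cons_tensor (single b 1) t))"])
      (simp_all, (intro linear_intros)+)
  have 2: "?f (tensor (single a 1) (cons_tensor p t)) =
      tensor p (push multiply_words (tensor (single a 1) t))" for a
    by (rule linear_extI[of "\<lambda>p. ?f (tensor (single a 1) (cons_tensor p t))", OF 1]; intro linear_intros)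
  show ?thesis
    by (rule linear_extI[of "\<lambda>s. ?f (tensor s (cons_tensor p t))", OF 2]; intro linear_intros)
qed

lemma push_append:
  "push (\<lambda>(l, m). l @ m) (tensor (tensor_list us) (tensor_list ws)) = tensor_list (us @ ws)"
proof (induction us)
  let ?f = "push (\<lambda>(l, m). l @ m)"
  case Nil
  have "?f (tensor (single [] 1) t) = t" for t :: "'a list \<Rightarrow>\<^sub>0 'b"
    by (rule linear_extI[of "\<lambda>t. ?f (tensor (single [] 1) t)" "\<lambda>t. t"])
      (simp_all, (intro linear_intros)+)
  then show ?case by simp
next
  let ?f = "push (\<lambda>(l, m). l @ m)"
  case (Cons u us)
  have 1: "?f (tensor (cons_tensor (single a 1) (single b 1)) t) =
      cons_tensor (single a 1) (?f (tensor (single b 1) t))" for a b and t :: "'a list \<Rightarrow>\<^sub>0 'b"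
    by (rule linear_extI[of "\<lambda>t. ?f (tensor (cons_tensor (single a 1) (single b 1)) t)"])
      (simp_all, (intro linear_intros)+)
  have 2: "?f (tensor (cons_tensor (single a 1) s) t) =
      cons_tensor (single a 1) (?f (tensor s t))" for a and s t :: "'a list \<Rightarrow>\<^sub>0 'b"
    by (rule linear_extI[of "\<lambda>s. ?f (tensor (cons_tensor (single a 1) s) t)", OF 1]; intro linear_intros)
  have "?f (tensor (cons_tensor u s) t) = cons_tensor u (?f (tensor s t))" for s t :: "'a list \<Rightarrow>\<^sub>0 'b"
    by (rule linear_extI[of "\<lambda>u. ?f (tensor (cons_tensor u s) t)", OF 2]; intro linear_intros)
  with Cons show ?case by simp
qed

text \<open>The specialisation for (iii). Writing the long tensor as a concatenation through
  \<open>push_append\<close> makes both of its halves available for linear extension.\<close>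

lemma push_take_drop:
  "push (\<lambda>(us, l). (take (length vs) us, multiply_words (drop (length vs) us, l)))
      (tensor (tensor_list (vs @ ws)) t) =
    tensor (tensor_list vs) (push multiply_words (tensor (tensor_list ws) t))"
proof -
  let ?d = "length vs"
  let ?f = "push (\<lambda>(us, l). (take ?d us, multiply_words (drop ?d us, l)))"
  let ?a = "push (\<lambda>(l, m). l @ m)"
  have 1: "?f (tensor (?a (tensor (single l 1) (single m 1))) t) =
      tensor (single l 1) (push multiply_words (tensor (single m 1) t))"
    if "length l = ?d" for l m and t :: "(nat \<times> nat) list \<Rightarrow>\<^sub>0 'a"
    by (rule linear_extI[of "\<lambda>t. ?f (tensor (?a (tensor (single l 1) (single m 1))) t)"])
      (simp_all add: that[symmetric], (intro linear_intros)+)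
  have 2: "?f (tensor (?a (tensor (single l 1) s)) t) =
      tensor (single l 1) (push multiply_words (tensor s t))"
    if "length l = ?d" for l s and t :: "(nat \<times> nat) list \<Rightarrow>\<^sub>0 'a"
    by (rule linear_extI[of "\<lambda>s. ?f (tensor (?a (tensor (single l 1) s)) t)", OF 1[OF that]]; intro linear_intros)
  have "?f (tensor (?a (tensor (tensor_list vs) s)) t) =
      tensor (tensor_list vs) (push multiply_words (tensor s t))" for s
  \<comment> \<open>Cutting at \<open>?d\<close> separates the halves only for prefixes of exactly
    that length, so the extension runs over the span of such words.\<close>
  proof (rule linear_eq_on_span[where S = "(\<lambda>l. single l 1) ` {l. length l = ?d}"
        and f = "\<lambda>v. ?f (tensor (?a (tensor v s)) t)"])
    show "tensor_list vs \<in> fs.span ((\<lambda>l. single l 1) ` {l. length l = ?d})"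
      by (rule in_span_singles, rule fs.span_base)
        (auto simp: in_keys_iff lookup_tensor_list split: if_splits)
  qed (use 2 in auto, (intro linear_intros)+)
  from this[of "tensor_list ws"] show ?thesis by (simp only: push_append)
qed

lemma push_add: "push f (u + v) = push f u + push f v"
  by (simp add: push_def lin_ext_add)

lemma single_eq_scl: "single i c = scl c (single i 1)"
  by (simp add: poly_mapping_eq_iff fun_eq_iff lookup_single when_def)

text \<open>The equivariance of the identification of E with the linear forms in X and Y.\<close>

lemma push_variable_natural_rep:
  "push variable (act natural_rep g u) = subst_XY g (push variable u)"
proof (rule linear_extI[of "\<lambda>u. push variable (act natural_rep g u)"])
  show "Vector_Spaces.linear scl scl (\<lambda>u. push variable (act natural_rep g u))"
    by (intro linear_intros) (simp add: natural_rep_def linear_lin_ext)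
  show "Vector_Spaces.linear scl scl (\<lambda>u. subst_XY g (push variable u))"
    by (rule linear_comp[OF linear_subst_XY linear_push])
  have push: "push variable (single i c) = single (variable i) c" for i and c :: 'a
  proof -
    have "push variable (single i c) = scl c (push variable (single i 1))"
      by (subst single_eq_scl) (simp only: push_def lin_ext_scl)
    also have "\<dots> = single (variable i) c"
      using single_eq_scl[of "variable i" c] by simp
    finally show ?thesis .
  qed
  show "push variable (act natural_rep g (single j 1)) = subst_XY g (push variable (single j 1))" for j
    using exhaust_2[of j]
    by (auto simp: natural_rep_def sum_2 push_add push
        variable_def exponent_def subst_XY_single)
qed

lemma act_tensor_single:
  "act (V \<otimes>\<^sub>S\<^sub>L W) g (single (i, j) 1) = tensor (act V g (single i 1)) (act W g (single j 1))"
  by (simp add: rep_tensor_def)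

lemma act_Sym_low_single:
  "act (Sym_low R V) g (single l 1) = tensor_list (map (\<lambda>i. act V g (single i 1)) l)"
  by (simp add: Sym_low_def rep_tensor_power_def)


section \<open>The kernel of each specialisation map is zero\<close>

section \<open>Injectivity\<close>

text \<open>After specialisation the value of a monomial depends only on \<open>f i\<close>.
  Grouping the sum by fibres of \<open>f\<close> leaves the coefficients of \<open>push f v\<close>,
  which are zero.\<close>

lemma push_eq_0_imp_sum_eq_0:
  fixes v :: "'i \<Rightarrow>\<^sub>0 'k::field" and h :: "'j \<Rightarrow> 'k poly"
  assumes S: "finite S" and v: "v \<in> class_functions S r" and 0: "push f v = 0"
    and F: "\<And>i. i \<in> S \<Longrightarrow> F i = h (f i)"
  shows "(\<Sum>i\<in>S. [:lookup v i:] * F i) = 0"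
proof -
  have keys: "keys v \<subseteq> S" using v by (simp add: class_functions_def)
  have const_sum: "(\<Sum>i\<in>A. [:c i:]) = [:\<Sum>i\<in>A. c i:]" for A and c :: "'i \<Rightarrow> 'k"
    by (induction A rule: infinite_finite_induct) auto
  have "(\<Sum>i\<in>S. [:lookup v i:] * F i) = (\<Sum>i\<in>S. [:lookup v i:] * h (f i))"
    by (simp add: F)
  also have "\<dots> = (\<Sum>j\<in>f ` S. \<Sum>i\<in>{i\<in>S. f i = j}. [:lookup v i:] * h (f i))"
    by (rule sum.image_gen[OF S])
  also have "\<dots> = (\<Sum>j\<in>f ` S. [:lookup (push f v) j:] * h j)"
    unfolding lookup_push[OF S keys] const_sum[symmetric] sum_distrib_right
    by (intro sum.cong) auto
  finally show ?thesis by (simp add: 0)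
qed

lemma bij_betw_permute_list_words:
  assumes \<sigma>: "\<sigma> permutes {..<R}"
  shows "bij_betw (permute_list \<sigma>) (words D R) (words D R)"
  by (rule bij_betw_byWitness[where f' = "permute_list (inv \<sigma>)"])
    (use \<sigma> permutes_inv[OF \<sigma>] in \<open>auto simp: permute_list_inverse\<close>)

text \<open>Permuting the points is undone by reindexing the sum over words, under which the
  coefficients are invariant.\<close>

lemma sum_words_symmetric:
  fixes u :: "'i list \<Rightarrow> 'k::field" and ps qs :: "'k poly list"
  assumes u: "\<And>l m. l \<in> words D R \<Longrightarrow> m \<in> words D R \<Longrightarrow> mset l = mset m \<Longrightarrow> u l = u m"
    and ps: "mset ps = mset qs" "length ps = R"
  shows "(\<Sum>l\<in>words D R. [:u l:] * (c * ev ps (map e l))) =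
    (\<Sum>l\<in>words D R. [:u l:] * (c * ev qs (map e l)))"
proof -
  from ps(1) obtain \<sigma> where \<sigma>: "\<sigma> permutes {..<length qs}" "permute_list \<sigma> qs = ps"
    by (rule mset_eq_permutation)
  have len: "length qs = R" using ps mset_eq_length by metis
  with \<sigma>(1) have \<sigma>': "\<sigma> permutes {..<R}" by simp
  have "(\<Sum>l\<in>words D R. [:u l:] * (c * ev ps (map e l))) =
      (\<Sum>l\<in>words D R. [:u (permute_list \<sigma> l):] * (c * ev ps (map e (permute_list \<sigma> l))))"
    by (rule sum.reindex_bij_betw[OF bij_betw_permute_list_words[OF \<sigma>'], symmetric])
  also have "\<dots> = (\<Sum>l\<in>words D R. [:u l:] * (c * ev qs (map e l)))"
  proof (rule sum.cong[OF refl])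
    fix l assume l: "l \<in> words D R"
    then have "u (permute_list \<sigma> l) = u l" using \<sigma>' by (intro u) auto
    moreover have "ev (permute_list \<sigma> qs) (permute_list \<sigma> (map e l)) = ev qs (map e l)"
      using l \<sigma>' len by (intro ev_permute) auto
    ultimately show "[:u (permute_list \<sigma> l):] * (c * ev ps (map e (permute_list \<sigma> l))) =
        [:u l:] * (c * ev qs (map e l))"
      using l \<sigma>' \<sigma>(2) by (simp add: permute_list_map)
  qed
  finally show ?thesis .
qed

text \<open>Here \<open>\<alpha>\<close> holds the exponents in the points to be interpolated and
  \<open>\<beta>\<close> those in the symmetric points. Symmetry lets \<open>ps\<close> be any
  arrangement of \<open>ys\<close> and \<open>xs\<close>, so each map can use its own order of
  points.\<close>

lemma push_injective:
  fixes v :: "'i \<Rightarrow>\<^sub>0 'k::field" and \<alpha> \<beta> :: "'i \<Rightarrow> nat list" and S :: "'i set"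
  defines "F \<equiv> \<lambda>xs ps. \<Sum>i\<in>S. [:lookup v i:] * (ev xs (\<alpha> i) * ev ps (\<beta> i))"
  assumes S: "finite S" and v: "v \<in> class_functions S r" and 0: "push f v = 0"
    and \<alpha>: "\<And>i. i \<in> S \<Longrightarrow> length (\<alpha> i) = n \<and> set (\<alpha> i) \<subseteq> {..e}"
    and \<beta>: "\<And>i. i \<in> S \<Longrightarrow> length (\<beta> i) = n + e"
    and inj: "\<And>i j. i \<in> S \<Longrightarrow> j \<in> S \<Longrightarrow> \<alpha> i = \<alpha> j \<Longrightarrow> \<beta> i = \<beta> j \<Longrightarrow> i = j"
    and sym: "\<And>xs ps qs. length ps = n + e \<Longrightarrow> mset ps = mset qs \<Longrightarrow> F xs ps = F xs qs"
    and diagonal: "\<And>xs ys :: 'k poly list. length xs = n \<Longrightarrow> length ys = e \<Longrightarrow>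
      \<exists>ps h. mset ps = mset ys + mset xs \<and> (\<forall>i\<in>S. ev xs (\<alpha> i) * ev ps (\<beta> i) = h (f i))"
  shows "v = 0"
proof (rule poly_mapping_eqI)
  fix i
  show "lookup v i = lookup 0 i"
  proof (cases "i \<in> S")
    case True
    have "lookup v i = 0"
    proof (rule specialisation_injective[OF S \<alpha> \<beta> _ sym[unfolded F_def] _ True])
      show "inj_on (\<lambda>i. \<alpha> i @ \<beta> i) S"
        using inj \<alpha> by (auto intro!: inj_onI)
      fix xs ys :: "'k poly list" assume len: "length xs = n" "length ys = e"
      from diagonal[OF len] obtain ps h where ps: "mset ps = mset (ys @ xs)"
        and h: "\<And>i. i \<in> S \<Longrightarrow> ev xs (\<alpha> i) * ev ps (\<beta> i) = h (f i)"
        by auto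
      from mset_eq_length[OF ps] len have "F xs (ys @ xs) = F xs ps"
        by (intro sym ps[symmetric]) simp
      also have "\<dots> = 0"
        unfolding F_def by (rule push_eq_0_imp_sum_eq_0[OF S v 0, where h = h]) (rule h)
      finally show "(\<Sum>i\<in>S. [:lookup v i:] * (ev xs (\<alpha> i) * ev (ys @ xs) (\<beta> i))) = 0"
        unfolding F_def .
    qed auto
    then show ?thesis by simp
  qed (use class_functionsD(1)[OF v] in simp)
qed

text \<open>Dehomogenising loses nothing: in a fixed degree the exponent of X determines the
  monomial.\<close>

lemma map_fst_monomials_inj:
  assumes "l \<in> words (monomials d) R" "m \<in> words (monomials d) R" "map fst l = map fst m"
  shows "l = m"
proof -
  have "inj_on fst (monomials d)" by (auto simp: inj_on_def)
  then have "inj_on fst (set l \<union> set m)" by (rule inj_on_subset) (use assms in simp)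
  with assms(3) show ?thesis by (rule map_inj_on)
qed

lemma map_exponent_inj: "map exponent us = map exponent ws \<Longrightarrow> us = ws"
proof -
  have "inj exponent" unfolding inj_def by (simp add: forall_2 exponent_def)
  then show "map exponent us = map exponent ws \<Longrightarrow> us = ws" by simp
qed

lemma map_fst_multiply_words:
  "map fst (multiply_words (us, l)) = map2 (+) (map exponent us) (map fst l)"
  by (simp add: multiply_words_def zip_map_map variable_def comp_def split_beta)

text \<open>The case \<open>n = 1\<close>, \<open>e = K\<close>: degree \<open>K\<close> in the
  single point W, symmetric in the \<open>1 + K\<close> points Z.\<close>

lemma push_multiply_head_injective:
  fixes v :: "(nat \<times> nat) \<times> (nat \<times> nat) list \<Rightarrow>\<^sub>0 'k::field"
  assumes v: "v \<in> class_functions (monomials K \<times> words (monomials d) (K + 1)) (map_prod id mset)"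
    and 0: "push (\<lambda>(w, l). (w + hd l, tl l)) v = 0"
  shows "v = 0"
proof (rule push_injective[OF _ v 0])
  let ?W = "words (monomials d) (K + 1)"
  let ?S = "monomials K \<times> ?W"
  let ?\<alpha> = "\<lambda>i :: (nat \<times> nat) \<times> (nat \<times> nat) list. [fst (fst i)]"
  let ?\<beta> = "\<lambda>i :: (nat \<times> nat) \<times> (nat \<times> nat) list. map fst (snd i)"
  show "finite ?S" by (intro finite_cartesian_product finite_words finite_monomials)
  show "length (?\<alpha> i) = 1 \<and> set (?\<alpha> i) \<subseteq> {..K}" "length (?\<beta> i) = 1 + K" if "i \<in> ?S" for i
    using that by auto
  show "i = j" if "i \<in> ?S" "j \<in> ?S" "?\<alpha> i = ?\<alpha> j" "?\<beta> i = ?\<beta> j" for i j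
    using that map_fst_monomials_inj[of "snd i" d "K + 1" "snd j"] by auto
  fix xs ys :: "'k poly list"
  show "(\<Sum>i\<in>?S. [:lookup v i:] * (ev xs (?\<alpha> i) * ev ps (?\<beta> i))) =
      (\<Sum>i\<in>?S. [:lookup v i:] * (ev xs (?\<alpha> i) * ev qs (?\<beta> i)))"
    if len: "length ps = 1 + K" and m: "mset ps = mset qs" for ps qs
    unfolding sum.cartesian_product' fst_conv snd_conv
    by (rule sum.cong[OF refl], rule sum_words_symmetric[OF _ m], rule class_functionsD(2)[OF v])
      (use len in auto)
  assume "length xs = 1" "length ys = K"
  then obtain x where xs: "xs = [x]" by (auto simp: length_Suc_conv)
  show "\<exists>ps h. mset ps = mset ys + mset xs \<and> (\<forall>i\<in>?S. ev xs (?\<alpha> i) * ev ps (?\<beta> i) =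
      h ((\<lambda>(w, l). (w + hd l, tl l)) i))"
  proof (intro exI conjI ballI)
    show "mset (x # ys) = mset ys + mset xs" by (simp add: xs)
    fix i assume "i \<in> ?S"
    then obtain a b p l where "i = ((a, b), p # l)" by (auto simp: length_Suc_conv)
    then show "ev xs (?\<alpha> i) * ev (x # ys) (?\<beta> i) =
        (\<lambda>(m, t). x ^ fst m * ev ys (map fst t)) ((\<lambda>(w, l). (w + hd l, tl l)) i)"
      by (simp add: xs power_add mult_ac)
  qed
qed

text \<open>The case \<open>n = K\<close>, \<open>e = 1\<close>: linear in each of the
  \<open>K\<close> points W, symmetric in the \<open>K + 1\<close> points Z. The one unmatched point
  \<open>y\<close> is the first Z.\<close>

lemma push_multiply_words_tail_injective:
  fixes v :: "2 list \<times> (nat \<times> nat) list \<Rightarrow>\<^sub>0 'k::field"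
  assumes v: "v \<in> class_functions (words UNIV K \<times> words (monomials d) (K + 1)) (map_prod mset mset)"
    and 0: "push (\<lambda>(us, l). (hd l, multiply_words (us, tl l))) v = 0"
  shows "v = 0"
proof (rule push_injective[OF _ v 0])
  let ?W = "words (monomials d) (K + 1)"
  let ?S = "words (UNIV :: 2 set) K \<times> ?W"
  let ?\<alpha> = "\<lambda>i :: 2 list \<times> (nat \<times> nat) list. map exponent (fst i)"
  let ?\<beta> = "\<lambda>i :: 2 list \<times> (nat \<times> nat) list. map fst (snd i)"
  show "finite ?S" by (intro finite_cartesian_product finite_words finite_monomials) simp
  show "length (?\<alpha> i) = K \<and> set (?\<alpha> i) \<subseteq> {..1}" "length (?\<beta> i) = K + 1" if "i \<in> ?S" for i
    using that by (auto simp: exponent_def)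
  show "i = j" if "i \<in> ?S" "j \<in> ?S" "?\<alpha> i = ?\<alpha> j" "?\<beta> i = ?\<beta> j" for i j
    by (intro prod_eqI map_exponent_inj[OF that(3)] map_fst_monomials_inj[OF _ _ that(4), of d "K + 1"])
      (use that(1,2) in auto)
  fix xs ys :: "'k poly list"
  show "(\<Sum>i\<in>?S. [:lookup v i:] * (ev xs (?\<alpha> i) * ev ps (?\<beta> i))) =
      (\<Sum>i\<in>?S. [:lookup v i:] * (ev xs (?\<alpha> i) * ev qs (?\<beta> i)))"
    if len: "length ps = K + 1" and m: "mset ps = mset qs" for ps qs
    unfolding sum.cartesian_product' fst_conv snd_conv
    by (rule sum.cong[OF refl], rule sum_words_symmetric[OF _ m], rule class_functionsD(2)[OF v])
      (use len in auto)
  assume len: "length xs = K" "length ys = 1"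
  then obtain y where ys: "ys = [y]" by (auto simp: length_Suc_conv)
  show "\<exists>ps h. mset ps = mset ys + mset xs \<and> (\<forall>i\<in>?S. ev xs (?\<alpha> i) * ev ps (?\<beta> i) =
      h ((\<lambda>(us, l). (hd l, multiply_words (us, tl l))) i))"
  proof (intro exI conjI ballI)
    show "mset (y # xs) = mset ys + mset xs" by (simp add: ys)
    fix i assume "i \<in> ?S"
    then obtain us p l where "i = (us, p # l)" "length us = K" "length l = K"
      by (auto simp: length_Suc_conv)
    then show "ev xs (?\<alpha> i) * ev (y # xs) (?\<beta> i) =
        (\<lambda>(m, t). y ^ fst m * ev xs (map fst t)) ((\<lambda>(us, l). (hd l, multiply_words (us, tl l))) i)"
      using len by (simp add: map_fst_multiply_words ev_add mult_ac)
  qed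
qed

text \<open>The case \<open>n = K\<close>, \<open>e = d\<close> with the factors exchanged:
  interpolation is in the \<open>K\<close> points Z, of degree at most \<open>d\<close> each, and
  the symmetry used is that of the \<open>d + K\<close> points W.\<close>

lemma push_take_drop_injective:
  fixes v :: "2 list \<times> (nat \<times> nat) list \<Rightarrow>\<^sub>0 'k::field"
  assumes v: "v \<in> class_functions (words UNIV (d + K) \<times> words (monomials d) K) (map_prod mset mset)"
    and 0: "push (\<lambda>(us, l). (take d us, multiply_words (drop d us, l))) v = 0"
  shows "v = 0"
proof (rule push_injective[OF _ v 0])
  let ?U = "words (UNIV :: 2 set) (d + K)"
  let ?W = "words (monomials d) K"
  let ?S = "?U \<times> ?W"
  let ?\<alpha> = "\<lambda>i :: 2 list \<times> (nat \<times> nat) list. map fst (snd i)"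
  let ?\<beta> = "\<lambda>i :: 2 list \<times> (nat \<times> nat) list. map exponent (fst i)"
  show "finite ?S" by (intro finite_cartesian_product finite_words finite_monomials) simp
  show "length (?\<alpha> i) = K \<and> set (?\<alpha> i) \<subseteq> {..d}" "length (?\<beta> i) = K + d" if "i \<in> ?S" for i
    using that by auto
  show "i = j" if "i \<in> ?S" "j \<in> ?S" "?\<alpha> i = ?\<alpha> j" "?\<beta> i = ?\<beta> j" for i j
    by (intro prod_eqI map_exponent_inj[OF that(4)] map_fst_monomials_inj[OF _ _ that(3), of d K])
      (use that(1,2) in auto)
  fix xs ys :: "'k poly list"
  show "(\<Sum>i\<in>?S. [:lookup v i:] * (ev xs (?\<alpha> i) * ev ps (?\<beta> i))) =
      (\<Sum>i\<in>?S. [:lookup v i:] * (ev xs (?\<alpha> i) * ev qs (?\<beta> i)))"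
    if len: "length ps = K + d" and m: "mset ps = mset qs" for ps qs
    \<comment> \<open>The symmetric points now belong to the first factor, so the sums are swapped
      to bring the sum over its words inside.\<close>
    unfolding sum.cartesian_product' fst_conv snd_conv sum.swap[of _ ?W ?U]
    by (rule sum.cong[OF refl], rule sum_words_symmetric[OF _ m], rule class_functionsD(2)[OF v])
      (use len in auto)
  assume len: "length xs = K" "length ys = d"
  show "\<exists>ps h. mset ps = mset ys + mset xs \<and> (\<forall>i\<in>?S. ev xs (?\<alpha> i) * ev ps (?\<beta> i) =
      h ((\<lambda>(us, l). (take d us, multiply_words (drop d us, l))) i))"
  proof (intro exI conjI ballI)
    show "mset (ys @ xs) = mset ys + mset xs" by simp
    fix i assume "i \<in> ?S"
    then obtain us l where i: "i = (us, l)" "length us = d + K" "length l = K" by auto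
    have "ev (ys @ xs) (map exponent us) =
        ev ys (map exponent (take d us)) * ev xs (map exponent (drop d us))"
      using len i(2) by (subst append_take_drop_id[of d us, symmetric], unfold map_append)
        (simp add: ev_append)
    then show "ev xs (?\<alpha> i) * ev (ys @ xs) (?\<beta> i) =
        (\<lambda>(a, t). ev ys (map exponent a) * ev xs (map fst t))
          ((\<lambda>(us, l). (take d us, multiply_words (drop d us, l))) i)"
      using len i by (simp add: map_fst_multiply_words ev_add mult_ac)
  qed
qed

section \<open>Dimension identities, fibres and assembly of the three isomorphisms\<close>

section \<open>The isomorphisms\<close>

lemma space_Sym_up_tensor_Sym_low:
  "space (Sym_up a \<otimes>\<^sub>S\<^sub>L Sym_low R (Sym_up d)) =
    class_functions (monomials a \<times> words (monomials d) R) (map_prod id mset)"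
  by (intro space_rep_tensor finite_monomials finite_words space_Sym_up space_Sym_low)

lemma space_Sym_low_tensor_Sym_low:
  "space (Sym_low a natural_rep \<otimes>\<^sub>S\<^sub>L Sym_low R (Sym_up d)) =
    class_functions (words UNIV a \<times> words (monomials d) R) (map_prod mset mset)"
  by (intro space_rep_tensor finite_monomials finite_words space_Sym_up space_natural_rep space_Sym_low) simp

lemma card_Sym_up_tensor_Sym_low:
  "card (map_prod id mset ` (monomials a \<times> words (monomials d) R)) = Suc a * (d + R choose R)"
  by (simp add: card_map_prod_image finite_monomials finite_words card_mset_words card_monomials)

lemma card_Sym_low_tensor_Sym_low:
  "card (map_prod mset mset ` (words (UNIV :: 2 set) a \<times> words (monomials d) R)) =
    Suc a * (d + R choose R)"
  unfolding card_map_prod_image[OF finite_words[OF finite] finite_words[OF finite_monomials]]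
    card_mset_words[OF finite] card_mset_words[OF finite_monomials] card_monomials
  by simp

lemmas is_rep_intros = is_rep_tensor is_rep_Sym_low is_rep_Sym_up is_rep_natural_rep

lemmas act_simps = act_tensor_single act_Sym_low_single

lemma act_Sym_up: "act (Sym_up d) = subst_XY"
  by (simp add: Sym_up_def)

lemma length_multiply_words [simp]:
  "length (multiply_words (us, l)) = min (length us) (length l)"
  by (simp add: multiply_words_def)

lemma set_multiply_words:
  "set l \<subseteq> monomials d \<Longrightarrow> set (multiply_words (us, l)) \<subseteq> monomials (d + 1)"
  by (auto simp: multiply_words_def variable_def exponent_def dest!: set_zip_rightD)

lemma permute_multiply_words:
  assumes "\<sigma> permutes {..<length l}" "length us = length l"
  shows "multiply_words (permute_list \<sigma> us, permute_list \<sigma> l) = permute_list \<sigma> (multiply_words (us, l))"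
  using assms by (simp add: multiply_words_def permute_list_map flip: permute_list_zip)

lemma permute_list_eq_iff:
  assumes "\<sigma> permutes {..<R}" "length l = R" "length m = R"
  shows "permute_list \<sigma> l = permute_list \<sigma> m \<longleftrightarrow> l = m"
  using permute_list_inverse(1)[of \<sigma>] assms by metis

text \<open>Substitution is multiplicative, so acting on a linear form and on a monomial separately
  agrees with acting on their product.\<close>

lemma subst_XY_variable:
  "map2 (\<lambda>u p. push variable u * p) (map (\<lambda>i. act natural_rep g (single i 1)) us)
      (map (\<lambda>i. subst_XY g (single i 1)) l) =
    map (\<lambda>i. subst_XY g (single i 1)) (multiply_words (us, l))"
  by (simp add: multiply_words_def zip_map_map comp_def split_beta push_variable_natural_rep
      subst_XY_mult[symmetric] mult_single)

lemma Sym_up_tensor_iso: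
  "(Sym_up K \<otimes>\<^sub>S\<^sub>L Sym_low (K + 1) (Sym_up d) :: ('k::field, _) sl2_rep)
    \<cong>\<^sub>S\<^sub>L Sym_up (d + K) \<otimes>\<^sub>S\<^sub>L Sym_low K (Sym_up d)"
proof (rule rep_iso_push[OF _ _ _ _ space_Sym_up_tensor_Sym_low space_Sym_up_tensor_Sym_low])
  let ?S = "monomials K \<times> words (monomials d) (K + 1)"
  let ?T = "monomials (d + K) \<times> words (monomials d) K"
  let ?f = "\<lambda>(w :: nat \<times> nat, l). (w + hd l, tl l)"
  \<comment> \<open>Both sides count dimensions. They agree by the absorption identity for binomial
    coefficients.\<close>
  show "card (map_prod id mset ` ?S) = card (map_prod id mset ` ?T)"
    unfolding card_Sym_up_tensor_Sym_low
    using Suc_times_binomial_eq[of "d + K" K] by (simp add: mult_ac)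
  show "?f i \<in> ?T" if i: "i \<in> ?S" for i
  proof -
    from i obtain a b p q l where "i = ((a, b), (p, q) # l)" by (auto simp: length_Suc_conv)
    with i show ?thesis by auto
  qed
  show "\<exists>\<pi>. inj_on \<pi> {i \<in> ?S. ?f i = j} \<and> (\<forall>i\<in>?S. ?f i = j \<longrightarrow>
      \<pi> i \<in> ?S \<and> ?f (\<pi> i) = j' \<and> map_prod id mset (\<pi> i) = map_prod id mset i)"
    if "j \<in> ?T" "j' \<in> ?T" "map_prod id mset j = map_prod id mset j'" for j j'
  proof -
    from that obtain m t t' where j: "j = (m, t)" "j' = (m, t')" "mset t = mset t'"
      by (cases j; cases j') auto
    have t': "length t' = length t" "set t' = set t"
      using j(3) by (auto dest: mset_eq_length mset_eq_setD)
    show ?thesis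
    proof (intro exI conjI ballI impI)
      \<comment> \<open>On the fibre over \<open>j\<close> the tail of \<open>l\<close> is
        \<open>t\<close>. Replacing it by its rearrangement \<open>t'\<close> keeps the multiset of
        \<open>l\<close>.\<close>
      let ?\<pi> = "\<lambda>(w, l). (w, hd l # t')"
      show "inj_on ?\<pi> {i \<in> ?S. ?f i = j}"
        by (rule inj_onI) (auto simp: j length_Suc_conv)
      fix i assume "i \<in> ?S" "?f i = j"
      then show "?\<pi> i \<in> ?S" "?f (?\<pi> i) = j'" "map_prod id mset (?\<pi> i) = map_prod id mset i"
        using j t' by (auto simp: length_Suc_conv)
    qed
  qed
  show "push ?f (act (Sym_up K \<otimes>\<^sub>S\<^sub>L Sym_low (K + 1) (Sym_up d)) g (single i 1)) =
      (act (Sym_up (d + K) \<otimes>\<^sub>S\<^sub>L Sym_low K (Sym_up d)) g (single (?f i) 1) :: _ \<Rightarrow>\<^sub>0 'k)"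
    if "i \<in> ?S" for g :: "'k^2^2" and i
  proof -
    from that obtain w p l where i: "i = (w, p # l)" by (auto simp: length_Suc_conv)
    show ?thesis
      by (simp add: i act_simps act_Sym_up push_multiply_head subst_XY_mult[symmetric] mult_single)
  qed
qed (rule is_rep_intros finite_cartesian_product finite_words finite_monomials finite |
    erule (1) push_multiply_head_injective)+

lemma Sym_low_natural_tensor_Sym_up_iso:
  "(Sym_low K natural_rep \<otimes>\<^sub>S\<^sub>L Sym_low (K + 1) (Sym_up d) :: ('k::field, _) sl2_rep)
    \<cong>\<^sub>S\<^sub>L Sym_up d \<otimes>\<^sub>S\<^sub>L Sym_low K (Sym_up (d + 1))"
proof (rule rep_iso_push[OF _ _ _ _ space_Sym_low_tensor_Sym_low space_Sym_up_tensor_Sym_low])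
  let ?S = "words (UNIV :: 2 set) K \<times> words (monomials d) (K + 1)"
  let ?T = "monomials d \<times> words (monomials (d + 1)) K"
  let ?f = "\<lambda>(us, l). (hd l, multiply_words (us, tl l))"
  show "card (map_prod mset mset ` ?S) = card (map_prod id mset ` ?T)"
    unfolding card_Sym_up_tensor_Sym_low card_Sym_low_tensor_Sym_low
    using Suc_times_binomial_add[of K d] by (simp add: mult_ac add_ac)
  show "?f i \<in> ?T" if i: "i \<in> ?S" for i
  proof -
    from i obtain us p l where "i = (us, p # l)" by (auto simp: length_Suc_conv)
    with i show ?thesis using set_multiply_words[of l d us] by auto
  qed
  show "\<exists>\<pi>. inj_on \<pi> {i \<in> ?S. ?f i = j} \<and> (\<forall>i\<in>?S. ?f i = j \<longrightarrow>
      \<pi> i \<in> ?S \<and> ?f (\<pi> i) = j' \<and> map_prod mset mset (\<pi> i) = map_prod mset mset i)"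
    if "j \<in> ?T" "j' \<in> ?T" "map_prod id mset j = map_prod id mset j'" for j j'
  proof -
    from that obtain m t t' where j: "j = (m, t)" "j' = (m, t')" and t: "mset t' = mset t" "length t = K"
      by (cases j; cases j') auto
    from t obtain \<sigma> where \<sigma>: "\<sigma> permutes {..<K}" "permute_list \<sigma> t = t'"
      by (metis mset_eq_permutation)
    show ?thesis
    proof (intro exI conjI ballI impI)
      \<comment> \<open>The permutation taking \<open>t\<close> to \<open>t'\<close> acts on both
        words at once, so that the same letters are still multiplied together. The head is left
        alone.\<close>
      let ?\<pi> = "\<lambda>(us, l). (permute_list \<sigma> us, hd l # permute_list \<sigma> (tl l))"
      show "inj_on ?\<pi> {i \<in> ?S. ?f i = j}"
      proof (rule inj_onI)
        fix i i' assume "i \<in> {i \<in> ?S. ?f i = j}" "i' \<in> {i \<in> ?S. ?f i = j}" and eq: "?\<pi> i = ?\<pi> i'"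
        then obtain us p l us' p' l' where i: "i = (us, p # l)" "i' = (us', p' # l')"
          and len: "length us = K" "length l = K" "length us' = K" "length l' = K"
          by (auto simp: length_Suc_conv)
        from eq show "i = i'" using len by (simp add: i permute_list_eq_iff[OF \<sigma>(1)])
      qed
      fix i assume i: "i \<in> ?S" "?f i = j"
      then obtain us l where eq: "i = (us, m # l)" "multiply_words (us, l) = t"
        and len: "length us = K" "length l = K"
        by (auto simp: j length_Suc_conv)
      show "?\<pi> i \<in> ?S" "map_prod mset mset (?\<pi> i) = map_prod mset mset i"
        using i \<sigma>(1) len by (auto simp: eq)
      show "?f (?\<pi> i) = j'"
        using \<sigma> len by (simp add: eq j permute_multiply_words)
    qed
  qed
  show "push ?f (act (Sym_low K natural_rep \<otimes>\<^sub>S\<^sub>L Sym_low (K + 1) (Sym_up d)) g (single i 1)) =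
      (act (Sym_up d \<otimes>\<^sub>S\<^sub>L Sym_low K (Sym_up (d + 1))) g (single (?f i) 1) :: _ \<Rightarrow>\<^sub>0 'k)"
    if "i \<in> ?S" for g :: "'k^2^2" and i
  proof -
    from that obtain us p l where i: "i = (us, p # l)" "length us = length l"
      by (auto simp: length_Suc_conv)
    then show ?thesis
      by (simp add: act_simps act_Sym_up push_multiply_words_tail push_multiply_words subst_XY_variable)
  qed
qed (rule is_rep_intros finite_cartesian_product finite_words finite_monomials finite |
    erule (1) push_multiply_words_tail_injective)+

lemma Sym_low_natural_tensor_iso:
  "(Sym_low (d + K) natural_rep \<otimes>\<^sub>S\<^sub>L Sym_low K (Sym_up d) :: ('k::field, _) sl2_rep)
    \<cong>\<^sub>S\<^sub>L Sym_low d natural_rep \<otimes>\<^sub>S\<^sub>L Sym_low K (Sym_up (d + 1))"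
proof (rule rep_iso_push[OF _ _ _ _ space_Sym_low_tensor_Sym_low space_Sym_low_tensor_Sym_low])
  let ?S = "words (UNIV :: 2 set) (d + K) \<times> words (monomials d) K"
  let ?T = "words (UNIV :: 2 set) d \<times> words (monomials (d + 1)) K"
  let ?f = "\<lambda>(us :: 2 list, l). (take d us, multiply_words (drop d us, l))"
  show "card (map_prod mset mset ` ?S) = card (map_prod mset mset ` ?T)"
    unfolding card_Sym_low_tensor_Sym_low
    using Suc_times_binomial_eq[of "d + K" K] Suc_times_binomial_add[of K d] by (simp add: mult_ac add_ac)
  show "?f i \<in> ?T" if i: "i \<in> ?S" for i
    using i set_multiply_words[of "snd i" d "drop d (fst i)"] by auto
  show "\<exists>\<pi>. inj_on \<pi> {i \<in> ?S. ?f i = j} \<and> (\<forall>i\<in>?S. ?f i = j \<longrightarrow>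
      \<pi> i \<in> ?S \<and> ?f (\<pi> i) = j' \<and> map_prod mset mset (\<pi> i) = map_prod mset mset i)"
    if "j \<in> ?T" "j' \<in> ?T" "map_prod mset mset j = map_prod mset mset j'" for j j'
  proof -
    from that obtain a a' t t' where j: "j = (a, t)" "j' = (a', t')"
      and t: "mset t' = mset t" "length t = K" and a: "mset a' = mset a" "length a' = d"
      by (cases j; cases j') auto
    from t obtain \<sigma> where \<sigma>: "\<sigma> permutes {..<K}" "permute_list \<sigma> t = t'"
      by (metis mset_eq_permutation)
    show ?thesis
    proof (intro exI conjI ballI impI)
      \<comment> \<open>The first \<open>d\<close> letters are replaced by their rearrangement
        \<open>a'\<close>, while the remaining letters move together with \<open>l\<close> as in
        (ii).\<close>
      let ?\<pi> = "\<lambda>(us, l). (a' @ permute_list \<sigma> (drop d us), permute_list \<sigma> l)"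
      \<comment> \<open>On the fibre over \<open>j\<close> the first \<open>d\<close> letters are
        always \<open>a\<close>, so overwriting them by \<open>a'\<close> loses no
        information.\<close>
      have fibre: "\<exists>us l. i = (a @ us, l) \<and> multiply_words (us, l) = t \<and> length us = K \<and> length l = K \<and>
          set l \<subseteq> monomials d \<and> length a = d" if "i \<in> ?S" "?f i = j" for i
        using that j by (auto intro!: exI[of _ "drop d (fst i)"] simp: append_take_drop_id[symmetric])
      show "inj_on ?\<pi> {i \<in> ?S. ?f i = j}"
      proof (rule inj_onI)
        fix i i' assume "i \<in> {i \<in> ?S. ?f i = j}" "i' \<in> {i \<in> ?S. ?f i = j}" and eq: "?\<pi> i = ?\<pi> i'"
        with fibre[of i] fibre[of i'] obtain us l us' l' where i: "i = (a @ us, l)" "i' = (a @ us', l')"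
          and len: "length us = K" "length l = K" "length us' = K" "length l' = K" "length a = d"
          by blast
        from eq show "i = i'" using len by (simp add: i permute_list_eq_iff[OF \<sigma>(1)])
      qed
      fix i assume i: "i \<in> ?S" "?f i = j"
      from fibre[OF this] obtain us l where eq: "i = (a @ us, l)" "multiply_words (us, l) = t"
        and len: "length us = K" "length l = K" "length a = d" and l: "set l \<subseteq> monomials d"
        by blast
      show "?\<pi> i \<in> ?S" "map_prod mset mset (?\<pi> i) = map_prod mset mset i"
        using l \<sigma>(1) len a by (auto simp: eq)
      show "?f (?\<pi> i) = j'"
        using \<sigma> len a by (simp add: eq j permute_multiply_words)
    qed
  qed
  show "push ?f (act (Sym_low (d + K) natural_rep \<otimes>\<^sub>S\<^sub>L Sym_low K (Sym_up d)) g (single i 1)) =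
      (act (Sym_low d natural_rep \<otimes>\<^sub>S\<^sub>L Sym_low K (Sym_up (d + 1))) g (single (?f i) 1) :: _ \<Rightarrow>\<^sub>0 'k)"
    if "i \<in> ?S" for g :: "'k^2^2" and i
  proof -
    define vs where "vs = take d (fst i)"
    define ws where "ws = drop d (fst i)"
    define l where "l = snd i"
    have i: "i = (vs @ ws, l)" and len: "d = length vs" "length ws = length l"
      using that by (auto simp: vs_def ws_def l_def)
    show ?thesis
      unfolding i len(1)
      using push_take_drop[of "map (\<lambda>i. act natural_rep g (single i 1)) vs"] len(2)
      by (simp add: act_simps act_Sym_up push_multiply_words subst_XY_variable)
  qed
qed (rule is_rep_intros finite_cartesian_product finite_words finite_monomials finite |
    erule (1) push_take_drop_injective)+

theorem corollary1p3:
  fixes K d :: nat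
  shows
    "((Sym_up (d + K) :: ('k::field, nat \<times> nat) sl2_rep) \<otimes>\<^sub>S\<^sub>L Sym_low K (Sym_up d)
        \<cong>\<^sub>S\<^sub>L Sym_up K \<otimes>\<^sub>S\<^sub>L Sym_low (K + 1) (Sym_up d)) \<and>
     (Sym_low K (natural_rep :: ('k, 2) sl2_rep) \<otimes>\<^sub>S\<^sub>L Sym_low (K + 1) (Sym_up d)
        \<cong>\<^sub>S\<^sub>L Sym_up d \<otimes>\<^sub>S\<^sub>L Sym_low K (Sym_up (d + 1))) \<and>
     (Sym_low (d + K) (natural_rep :: ('k, 2) sl2_rep) \<otimes>\<^sub>S\<^sub>L Sym_low K (Sym_up d)
        \<cong>\<^sub>S\<^sub>L Sym_low d natural_rep \<otimes>\<^sub>S\<^sub>L Sym_low K (Sym_up (d + 1)))"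
  using rep_iso_sym[OF Sym_up_tensor_iso] Sym_low_natural_tensor_Sym_up_iso Sym_low_natural_tensor_iso by blast

end
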